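(* There is a universal constant $C>0$ such that the following holds. Let $K\subseteq\mathbb{R}^n$ be a symmetric convex body. There is an online algorithm that, against any oblivious adversary and for any sequence of vectors $v_1,\ldots,v_T\in\mathbb{R}^n$ with $\|v_i\|_2\le 1$ arriving one at a time, decides random signs $x_1,\ldots,x_T\in\{-1,1\}$ such that: (a) if $\gamma_n(K)\ge\frac12$, then with probability at least $1/2$ one has $\sum_{i=1}^T x_iv_i\in C\cdot K$; (b) if $\gamma_n(K)\ge 1-\frac{1}{2T}$, then with probability at least $1/2$ one has $\sum_{i=1}^t x_iv_i\in C\cdot K$ for all $t\in[T]$.
   Context: $\gamma_n$ denotes the standard Gaussian measure on $\mathbb{R}^n$. A convex body is a convex, compact, full-dimensional set. It is symmetric if $K=-K$. Online setting: the vectors are revealed one at a time. After $v_i$ is revealed, the algorithm must irrevocably choose $x_i\in\{-1,1\}$, possibly using randomness, based only on $v_1,\ldots,v_i$ and $x_1,\ldots,x_{i-1}$. An oblivious adversary fixes the whole sequence of vectors in advance, independently of the algorithm's random choices. *)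

theory Defs
  imports "HOL-Probability.Probability"
begin

text \<open>
  The constant of the theorem is independent of the dimension, so the dimension has to be a
  natural number that can be quantified inside a formula, not a type.  We use the carrier of
  \<^const>\<open>Euclidean_space\<close>: a vector of dimension \<open>n\<close> is a function \<open>x :: nat \<Rightarrow> real\<close> whose
  coordinates \<open>x i\<close> with \<open>i \<ge> n\<close> vanish.  Since \<^typ>\<open>nat \<Rightarrow> real\<close> is not an instance of
  \<^class>\<open>real_vector\<close>, convexity, scaling and linear combinations are written coordinatewise.
\<close>

definition euclidean_norm :: "nat \<Rightarrow> (nat \<Rightarrow> real) \<Rightarrow> real" where
  "euclidean_norm n x = L2_set x {..<n}"

definition scale_set :: "real \<Rightarrow> (nat \<Rightarrow> real) set \<Rightarrow> (nat \<Rightarrow> real) set" where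
  "scale_set c K = (\<lambda>x i. c * x i) ` K"

definition convex_fun_set :: "(nat \<Rightarrow> real) set \<Rightarrow> bool" where
  "convex_fun_set K \<longleftrightarrow>
     (\<forall>x\<in>K. \<forall>y\<in>K. \<forall>u\<ge>0. \<forall>v\<ge>0. u + v = 1 \<longrightarrow> (\<lambda>i. u * x i + v * y i) \<in> K)"

text \<open>Full-dimensional is understood as having nonempty interior in n-space.\<close>

definition convex_body :: "nat \<Rightarrow> (nat \<Rightarrow> real) set \<Rightarrow> bool" where
  "convex_body n K \<longleftrightarrow>
     convex_fun_set K \<and> compactin (Euclidean_space n) K \<and> Euclidean_space n interior_of K \<noteq> {}"

definition symmetric_set :: "(nat \<Rightarrow> real) set \<Rightarrow> bool" where
  "symmetric_set K \<longleftrightarrow> K = (\<lambda>x i. - x i) ` K"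

text \<open>
  The standard Gaussian measure is the n-fold product of the standard normal distribution.
  Elements of the product space are \<^const>\<open>undefined\<close> outside \<open>{..<n}\<close>, hence the transport to
  functions that are zero there.
\<close>

definition zero_extend :: "nat \<Rightarrow> (nat \<Rightarrow> real) \<Rightarrow> nat \<Rightarrow> real" where
  "zero_extend n x = (\<lambda>i. if i < n then x i else 0)"

definition gaussian_measure :: "nat \<Rightarrow> (nat \<Rightarrow> real) measure" where
  "gaussian_measure n =
     distr (\<Pi>\<^sub>M i\<in>{..<n}. std_normal_distribution) borel (zero_extend n)"

text \<open>
  A randomized online algorithm maps the vectors \<open>[v\<^sub>1, \<dots>, v\<^sub>i]\<close> revealed so far and the earlier
  signs \<open>[x\<^sub>1, \<dots>, x\<^sub>i\<^sub>-\<^sub>1]\<close> to the distribution of the next sign \<open>x\<^sub>i\<close>.  The number \<open>T\<close> of vectors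
  is not part of its input.
\<close>

type_synonym online_algorithm = "(nat \<Rightarrow> real) list \<Rightarrow> real list \<Rightarrow> real pmf"

definition sign_valued :: "online_algorithm \<Rightarrow> bool" where
  "sign_valued A \<longleftrightarrow> (\<forall>vs xs. set_pmf (A vs xs) \<subseteq> {-1, 1})"

text \<open>
  \<open>run_online A v t\<close> is the joint distribution of the signs \<open>x 1, \<dots>, x t\<close> when the input
  \<open>v 1, v 2, \<dots>\<close> is fixed in advance (oblivious adversary); the other values of \<open>x\<close> are a dummy 0.
\<close>

primrec run_online ::
  "online_algorithm \<Rightarrow> (nat \<Rightarrow> nat \<Rightarrow> real) \<Rightarrow> nat \<Rightarrow> (nat \<Rightarrow> real) pmf" where
  "run_online A v 0 = return_pmf (\<lambda>_. 0)"
| "run_online A v (Suc t) =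
     bind_pmf (run_online A v t)
       (\<lambda>x. map_pmf (\<lambda>s. x(Suc t := s))
          (A (map v [1..<Suc (Suc t)]) (map x [1..<Suc t])))"

definition signed_sum :: "(nat \<Rightarrow> nat \<Rightarrow> real) \<Rightarrow> (nat \<Rightarrow> real) \<Rightarrow> nat \<Rightarrow> nat \<Rightarrow> real" where
  "signed_sum v x t = (\<lambda>k. \<Sum>i = 1..t. x i * v i k)"

text \<open>Well-definedness: the Gaussian measure is a probability measure, and bodies are Borel.\<close>

lemma measurable_zero_extend [measurable]:
  "zero_extend n \<in> borel_measurable (\<Pi>\<^sub>M i\<in>{..<n}. std_normal_distribution)"
proof (rule measurable_coordinatewise_then_product)
  fix i
  show "(\<lambda>x. zero_extend n x i) \<in> borel_measurable (\<Pi>\<^sub>M i\<in>{..<n}. std_normal_distribution)"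
  proof (cases "i < n")
    case True
    have "(\<lambda>x. x i) \<in> measurable (\<Pi>\<^sub>M i\<in>{..<n}. std_normal_distribution) std_normal_distribution"
      using True by (intro measurable_component_singleton) simp
    then show ?thesis
      using True by (simp add: zero_extend_def)
  qed (simp add: zero_extend_def)
qed

lemma prob_space_gaussian_measure: "prob_space (gaussian_measure n)"
  unfolding gaussian_measure_def
  by (intro prob_space.prob_space_distr prob_space_PiM measurable_zero_extend)
     (simp add: prob_space_normal_density)

lemma sets_gaussian_measure [simp]: "sets (gaussian_measure n) = sets borel"
  by (simp add: gaussian_measure_def)

lemma convex_body_borel:
  assumes "convex_body n K"
  shows "K \<in> sets borel"
proof -
  have "compactin (powertop_real UNIV) K"
    using assms by (simp add: convex_body_def Euclidean_space_def compactin_subtopology)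
  moreover have "Hausdorff_space (powertop_real (UNIV :: nat set))"
    by (simp add: Hausdorff_space_product_topology)
  ultimately have "closedin (powertop_real UNIV) K"
    by (rule compactin_imp_closedin[rotated])
  then show ?thesis
    by (simp add: borel_closed euclidean_product_topology flip: closed_closedin)
qed

end

theory Submission
  imports Defs "HOL-Library.Function_Algebras"
begin

text \<open>
  For a convex \<open>f \<ge> 0\<close> let \<open>f * v\<close> be the infimum over \<open>\<bar>s\<bar> \<le> 2\<close> of
  \<open>max (f (x + (s - 1) v)) (f (x + (s + 1) v))\<close>.  It is convex, it dominates the minimum of
  \<open>f (x + v)\<close> and \<open>f (x - v)\<close>, and its Gaussian mean does not exceed that of \<open>f\<close> when \<open>v\<close> is short.
  Given weights on finitely many input sequences, backward induction along their prefix tree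
  (sum over the possible next vectors \<open>v\<close> of \<open>f\<^sub>v * v\<close>) therefore produces a convex upper bound for the
  optimal expected cost from a position, and its value at 0 is at most its Gaussian mean.  So some
  deterministic online strategy has weighted cost at most that of a Gaussian position.  A minimax
  argument and compactness of the set of randomised strategies give one randomised strategy
  with \<open>E \<phi> (position) \<le> E \<phi> (Gaussian)\<close> for all input sequences and all times.

  This is applied to \<open>\<phi> = max 0 (N - 1)\<close> where \<open>N\<close> is the gauge of \<open>K\<close>.  Fernique's inequality bounds the
  Gaussian mean of \<open>\<phi>\<close> by \<open>16 (1 - \<gamma> K)\<close>, and Markov's inequality with a union bound over the times
  yields both parts.
\<close>

section \<open>Recentring convex functions on a line\<close>

text \<open>Part (b) dictates the cost. A union bound over T times needs an expected cost of order
  1/T at each of them, and the mean of the gauge need not be small; truncating the gauge at 1 makes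
  the mean linear in the missing mass of \<open>K\<close>. The indicator of the complement of
  \<open>K\<close> would have that mean too, but it is not convex, and the comparison with a
  Gaussian position works line by line for convex functions. The quantifiers are the second
  obstacle: one algorithm, ignorant of T, has to serve every sequence. A value function exists only
  against fixed weights on finitely many sequences; sequences with a common prefix must receive the
  same signs on it, which is why the induction runs along a tree. Obliviousness enters here, since
  the weights do not react to the signs. Recentring preserves Gaussian means only along vectors that
  are short compared with the unit variance, so inputs are divided by 8.\<close>

instantiation "fun" :: (type, real_vector) real_vector
begin

definition scaleR_fun_def: "scaleR c f = (\<lambda>x. c *\<^sub>R f x)"

instance
  by standard (simp_all add: scaleR_fun_def fun_eq_iff scaleR_add_right scaleR_add_left)

end

lemma scaleR_fun_apply [simp]: "(c *\<^sub>R f) x = c *\<^sub>R f x"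
  by (simp add: scaleR_fun_def)

text \<open>The secant inequality with denominators cleared, so that it also applies to coinciding
  points.\<close>

lemma convex_on_three_points:
  fixes F :: "real \<Rightarrow> real"
  assumes "convex_on UNIV F" "a \<le> b" "b \<le> c"
  shows "(c - a) * F b \<le> (c - b) * F a + (b - a) * F c"
proof (cases "a = c")
  case False
  then have ac: "a < c" using assms by simp
  have "F (((c - b) / (c - a)) *\<^sub>R a + ((b - a) / (c - a)) *\<^sub>R c)
      \<le> (c - b) / (c - a) * F a + (b - a) / (c - a) * F c"
    using assms(1)[unfolded convex_on_def, THEN conjunct2, rule_format, of a c "(c - b) / (c - a)" "(b - a) / (c - a)"]
      assms(2,3) ac by (simp add: divide_simps)
  also have "((c - b) / (c - a)) *\<^sub>R a + ((b - a) / (c - a)) *\<^sub>R c = b"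
    using ac by (simp add: divide_simps) (simp add: algebra_simps)
  finally show ?thesis
    using ac by (simp add: divide_simps mult.commute split: if_splits)
qed (use assms in simp)

text \<open>Equal values at distance 1 from \<open>y\<close> on both sides make \<open>F\<close>
  nondecreasing beyond \<open>y + 1\<close>. Its slope there is at least that of the secant from
  \<open>m\<close> to \<open>y + 1\<close>, points at distance at most 2, so one unit step to the
  left gains half of the drop \<open>F (y + 1) - F m\<close>. The points \<open>t - 3\<close> and
  \<open>t - 1\<close> form the window for the shift -2.\<close>

lemma convex_on_right_gain:
  fixes F :: "real \<Rightarrow> real"
  assumes F: "convex_on UNIV F" and bal: "F (y - 1) = F (y + 1)"
    and m: "y - 1 \<le> m" "m \<le> y + 1" "F m \<le> F (y + 1)" and t: "y + 2 \<le> t"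
  shows "max (F (t - 3)) (F (t - 1)) + (F (y + 1) - F m) / 2 \<le> F t"
proof -
  note three = convex_on_three_points[OF F]
  have mono: "F a \<le> F b" if "y + 1 \<le> a" "a \<le> b" for a b
  proof -
    have "(a - (y - 1)) * F (y + 1) \<le> (a - (y + 1)) * F (y - 1) + 2 * F a"
      using three[of "y - 1" "y + 1" a] that by simp
    then have ca: "F (y + 1) \<le> F a" using bal by (simp add: algebra_simps)
    have "(b - (y - 1)) * F a \<le> (b - a) * F (y - 1) + (a - (y - 1)) * F b"
      using three[of "y - 1" a b] that by simp
    also have "\<dots> \<le> (b - a) * F a + (a - (y - 1)) * F b"
      using that ca bal by (simp add: mult_left_mono)
    finally have "(a - (y - 1)) * F a \<le> (a - (y - 1)) * F b" by (simp add: algebra_simps)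
    then show ?thesis using that by simp
  qed
  have inside: "F a \<le> F (y + 1)" if "y - 1 \<le> a" "a \<le> y + 1" for a
    using three[of "y - 1" a "y + 1"] that bal by (simp add: algebra_simps)
  have "F (t - 3) \<le> F (t - 1)"
  proof (cases "t - 3 \<le> y + 1")
    case True
    then show ?thesis using inside[of "t - 3"] mono[of "y + 1" "t - 1"] t by simp
  next
    case False
    then show ?thesis using mono[of "t - 3" "t - 1"] by simp
  qed
  moreover have "F (t - 1) + (F (y + 1) - F m) / 2 \<le> F t"
  proof (cases "m = y + 1")
    case True
    then show ?thesis using mono[of "t - 1" t] t by simp
  next
    case False
    define A where "A = t - 1"
    define d where "d = F (y + 1) - F m"
    have A: "y + 1 \<le> A" "m < y + 1" "m < A" using False m t by (auto simp: A_def)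
    have "(A - m) * F (y + 1) \<le> (A - (y + 1)) * F m + (y + 1 - m) * F A"
      using three[of m "y + 1" A] A m by simp
    then have "(A - m) * d \<le> (y + 1 - m) * (F A - F m)" by (simp add: d_def algebra_simps)
    also have "\<dots> \<le> 2 * (F A - F m)"
      using m mono[of "y + 1" A] A by (intro mult_right_mono) auto
    finally have 1: "(A - m) * d \<le> 2 * (F A - F m)" .
    \<comment> \<open>Secant slopes increase: the slope from \<open>m\<close> to \<open>A\<close> is
      at most the one from \<open>A\<close> to \<open>t\<close>, and
      \<open>t - A = 1\<close>.\<close>
    have "(t - m) * F A \<le> F m + (A - m) * F t"
      using three[of m A t] A by (simp add: A_def)
    then have "F A - F m \<le> (A - m) * (F t - F A)" by (simp add: A_def algebra_simps)
    then have "(A - m) * d \<le> (A - m) * (2 * (F t - F A))" using 1 by (simp add: algebra_simps)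
    then have "d \<le> 2 * (F t - F A)" using A by (simp only: mult_le_cancel_left_pos)
    then show ?thesis by (simp add: d_def A_def field_simps)
  qed
  ultimately show ?thesis by simp
qed

text \<open>A recentred value \<open>g\<close> can exceed \<open>F t\<close> only for
  \<open>t\<close> within 1 of the trough \<open>y\<close>, and by at most the depth
  \<open>d\<close> of the trough. At distance 2 or more a shift by 2 towards \<open>y\<close> gains
  \<open>d / 2\<close>; in between, moving the window onto \<open>y - 1\<close> and
  \<open>y + 1\<close> loses nothing. Since \<open>y\<close> and \<open>d\<close> depend on
  \<open>F\<close> alone, the inequality can be integrated over \<open>t\<close>.\<close>

lemma convex_on_window_exchange:
  fixes F :: "real \<Rightarrow> real"
  assumes F: "convex_on UNIV F"
  obtains y d where "d \<ge> 0"
    and "\<And>t g. (\<And>s. \<bar>s\<bar> \<le> 2 \<Longrightarrow> g \<le> max (F (t + s - 1)) (F (t + s + 1))) \<Longrightarrow>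
      g + (if \<bar>t - y\<bar> \<ge> 2 then d / 2 else 0) \<le> F t + (if \<bar>t - y\<bar> \<le> 1 then d else 0)"
proof -
  note three = convex_on_three_points[OF F]
  have cont: "continuous_on A F" for A
    using convex_on_continuous[OF open_UNIV F] continuous_on_subset by blast
  define D where "D y = F (y + 1) - F (y - 1)" for y
  have contD: "continuous_on A D" for A
    unfolding D_def by (intro continuous_intros continuous_on_compose2[OF cont[of UNIV]]) auto
  \<comment> \<open>A zero of \<open>D\<close> is a balanced window. Without one, \<open>D\<close>
    has constant sign by the intermediate value theorem; then shifting by 2 always in the same
    direction never loses, and \<open>d = 0\<close> suffices.\<close>
  consider y where "D y = 0" | "\<And>y. D y > 0" | "\<And>y. D y < 0"
  proof (cases "\<exists>y. D y = 0")
    case False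
    have "\<not> (D a < 0 \<and> D b > 0)" for a b
    proof
      assume ab: "D a < 0 \<and> D b > 0"
      show False
        using IVT'[of D a 0 b] IVT2'[of D a 0 b] ab contD False by (cases "a \<le> b") force+
    qed
    then show ?thesis using that False by (metis linorder_neqE_linordered_idom)
  qed auto
  then show thesis
  proof cases
    case (1 y)
    then have bal: "F (y - 1) = F (y + 1)" by (simp add: D_def)
    obtain m where m: "y - 1 \<le> m" "m \<le> y + 1" and min: "\<And>x. y - 1 \<le> x \<Longrightarrow> x \<le> y + 1 \<Longrightarrow> F m \<le> F x"
      using continuous_attains_inf[of "{y - 1..y + 1}" F] cont by force
    define d where "d = F (y + 1) - F m"
    have Fm: "F m \<le> F (y + 1)" using min[of "y + 1"] m by simp
    have F': "convex_on UNIV (\<lambda>x. F (- x))"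
    proof (rule convex_onI)
      fix t x y :: real assume "0 < t" "t < 1"
      then show "F (- ((1 - t) *\<^sub>R x + t *\<^sub>R y)) \<le> (1 - t) * F (- x) + t * F (- y)"
        using convex_onD[OF F, of t "- x" "- y"] by (simp add: algebra_simps)
    qed simp
    show thesis
    proof (rule that)
      show "d \<ge> 0" using Fm by (simp add: d_def)
      fix t g assume g: "\<And>s. \<bar>s\<bar> \<le> 2 \<Longrightarrow> g \<le> max (F (t + s - 1)) (F (t + s + 1))"
      consider "y + 2 \<le> t" | "t \<le> y - 2" | "\<bar>t - y\<bar> < 2" by linarith
      then show "g + (if \<bar>t - y\<bar> \<ge> 2 then d / 2 else 0) \<le> F t + (if \<bar>t - y\<bar> \<le> 1 then d else 0)"
      proof cases
        case 1
        then show ?thesis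
          using convex_on_right_gain[OF F bal m Fm 1] g[of "-2"] by (simp add: d_def)
      next
        case 2
        have "max (F (t + 3)) (F (t + 1)) + (F (y - 1) - F m) / 2 \<le> F t"
          using convex_on_right_gain[OF F', of "- y" "- m" "- t"] bal m Fm 2
          by (simp add: algebra_simps)
        moreover have "g \<le> max (F (t + 3)) (F (t + 1))"
          using g[of 2] by (simp add: algebra_simps max.commute)
        ultimately show ?thesis using 2 bal by (simp add: d_def)
      next
        case 3
        have "g \<le> F (y + 1)" using g[of "y - t"] bal 3 by (simp add: algebra_simps abs_minus_commute)
        moreover have "F (y + 1) \<le> F t" if "1 < \<bar>t - y\<bar>"
        proof (cases "y + 1 \<le> t")
          case True
          then show ?thesis
            using three[of "y - 1" "y + 1" t] bal by (simp add: algebra_simps)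
        next
          case False
          then have "t \<le> y - 1" using that by linarith
          then show ?thesis
            using three[of t "y - 1" "y + 1"] bal by (simp add: algebra_simps)
        qed
        moreover have "F (y + 1) \<le> F t + d" if "\<bar>t - y\<bar> \<le> 1"
          using min[of t] that by (simp add: d_def abs_le_iff algebra_simps)
        ultimately show ?thesis using 3 by auto
      qed
    qed
  next
    case 2
    show thesis
    proof (rule that[of 0 0])
      fix t g assume g: "\<And>s. \<bar>s\<bar> \<le> 2 \<Longrightarrow> g \<le> max (F (t + s - 1)) (F (t + s + 1))"
      have "2 * F (t - 1) \<le> F (t - 2) + F t" using three[of "t - 2" "t - 1" t] by simp
      then show "g + (if \<bar>t - 0\<bar> \<ge> 2 then 0 / 2 else 0) \<le> F t + (if \<bar>t - 0\<bar> \<le> 1 then 0 else 0)"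
        using g[of "-2"] 2[of "t - 2"] 2[of "t - 1"] by (simp add: D_def algebra_simps)
    qed simp
  next
    case 3
    show thesis
    proof (rule that[of 0 0])
      fix t g assume g: "\<And>s. \<bar>s\<bar> \<le> 2 \<Longrightarrow> g \<le> max (F (t + s - 1)) (F (t + s + 1))"
      have "2 * F (t + 1) \<le> F (t + 2) + F t" using three[of t "t + 1" "t + 2"] by simp
      then show "g + (if \<bar>t - 0\<bar> \<ge> 2 then 0 / 2 else 0) \<le> F t + (if \<bar>t - 0\<bar> \<le> 1 then 0 else 0)"
        using g[of 2] 3[of "t + 2"] 3[of "t + 1"] by (simp add: D_def algebra_simps)
    qed simp
  qed
qed

text \<open>Length times the peak \<open>1 / sqrt (32 * pi)\<close> of the density, rounded up to
  \<open>1 / 9\<close>. The bound is uniform in the mean, which varies from line to line in the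
  application.\<close>

lemma normal_density_interval_le:
  assumes "0 \<le> r"
  shows "emeasure (density lborel (normal_density \<mu> 4)) {y - r..y + r} \<le> ennreal (2 * r / 9)"
proof -
  have "sqrt 81 \<le> sqrt (32 * pi)" using pi_gt3 by (intro real_sqrt_le_mono) simp
  then have s: "9 \<le> sqrt (32 * pi)" by (simp add: real_sqrt_eq_iff)
  have le: "normal_density \<mu> 4 x \<le> 1 / 9" for x
  proof -
    have "exp (- (x - \<mu>)\<^sup>2 / 32) / sqrt (32 * pi) \<le> 1 / 9"
      using s by (intro frac_le) auto
    then show ?thesis by (simp add: normal_density_def mult.commute)
  qed
  have "emeasure (density lborel (normal_density \<mu> 4)) {y - r..y + r}
      = (\<integral>\<^sup>+x. ennreal (normal_density \<mu> 4 x) * indicator {y - r..y + r} x \<partial>lborel)"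
    by (simp add: emeasure_density)
  also have "\<dots> \<le> (\<integral>\<^sup>+x. ennreal (1 / 9) * indicator {y - r..y + r} x \<partial>lborel)"
    by (intro nn_integral_mono mult_right_mono ennreal_leI le) simp
  also have "\<dots> = ennreal (1 / 9) * ennreal (2 * r)"
    using assms by (simp add: nn_integral_cmult)
  also have "\<dots> = ennreal (2 * r / 9)"
    using assms by (subst ennreal_mult[symmetric]) auto
  finally show ?thesis .
qed

text \<open>Standard deviation 4 is large compared with the unit step, so the mass of the central window
  is at most half of that of the two tails.\<close>

lemma nn_integral_convex_window_le:
  fixes F g :: "real \<Rightarrow> real"
  assumes F: "convex_on UNIV F" and g0: "\<And>t. 0 \<le> g t" and F0: "\<And>t. 0 \<le> F t"
    and [measurable]: "g \<in> borel_measurable borel"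
    and g: "\<And>t s. \<bar>s\<bar> \<le> 2 \<Longrightarrow> g t \<le> max (F (t + s - 1)) (F (t + s + 1))"
  shows "(\<integral>\<^sup>+t. g t \<partial>density lborel (normal_density \<mu> 4)) \<le> (\<integral>\<^sup>+t. F t \<partial>density lborel (normal_density \<mu> 4))"
    (is "integral\<^sup>N ?N _ \<le> _")
proof -
  interpret prob_space ?N by (rule prob_space_normal_density) simp
  have [measurable]: "F \<in> borel_measurable borel"
    using convex_on_continuous[OF open_UNIV F] by (rule borel_measurable_continuous_onI)
  obtain y d where d: "d \<ge> 0" and ex: "\<And>t. g t + (if \<bar>t - y\<bar> \<ge> 2 then d / 2 else 0) \<le> F t + (if \<bar>t - y\<bar> \<le> 1 then d else 0)"
    using convex_on_window_exchange[OF F] g by metis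
  let ?W = "{t. \<bar>t - y\<bar> \<ge> 2}"
  have [measurable]: "?W \<in> sets borel" by measurable
  have W: "emeasure ?N ?W \<ge> ennreal (5 / 9)"
  proof -
    have I: "emeasure ?N {y - 2..y + 2} \<le> ennreal (4 / 9)"
      using normal_density_interval_le[of 2 \<mu> y] by simp
    have "1 = emeasure ?N (space ?N)" using emeasure_space_1 by simp
    also have "\<dots> \<le> emeasure ?N ({y - 2..y + 2} \<union> ?W)"
      by (intro emeasure_mono) auto
    also have "\<dots> \<le> emeasure ?N {y - 2..y + 2} + emeasure ?N ?W"
      by (intro emeasure_subadditive) auto
    also have "\<dots> \<le> ennreal (4 / 9) + emeasure ?N ?W" using I by (intro add_right_mono)
    finally have "ennreal (4 / 9) + ennreal (5 / 9) \<le> ennreal (4 / 9) + emeasure ?N ?W"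
      by (simp flip: ennreal_plus)
    then show ?thesis by (simp add: ennreal_add_left_cancel_le)
  qed
  \<comment> \<open>The loss near \<open>y\<close> is at most \<open>2 * d / 9\<close>, the gain on
    the tails at least \<open>d / 2\<close> times \<open>5 / 9\<close>, which is larger. The finite
    amount \<open>2 * d / 9\<close> is carried on both sides and cancelled at the end, since the
    integrals may be infinite.\<close>
  have "integral\<^sup>N ?N g + ennreal (2 * d / 9) \<le> integral\<^sup>N ?N g + ennreal (d / 2) * emeasure ?N ?W"
  proof (intro add_left_mono)
    have "ennreal (2 * d / 9) \<le> ennreal (d / 2) * ennreal (5 / 9)"
      using d by (subst ennreal_mult[symmetric]) (auto intro!: ennreal_leI)
    also have "\<dots> \<le> ennreal (d / 2) * emeasure ?N ?W" by (intro mult_left_mono W) simp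
    finally show "ennreal (2 * d / 9) \<le> ennreal (d / 2) * emeasure ?N ?W" .
  qed
  also have "\<dots> = (\<integral>\<^sup>+t. ennreal (g t) + ennreal (d / 2) * indicator ?W t \<partial>?N)"
    by (simp add: nn_integral_add nn_integral_cmult)
  also have "\<dots> \<le> (\<integral>\<^sup>+t. ennreal (F t) + ennreal d * indicator {y - 1..y + 1} t \<partial>?N)"
  proof (intro nn_integral_mono)
    fix t
    have "ennreal (g t + (if \<bar>t - y\<bar> \<ge> 2 then d / 2 else 0)) \<le> ennreal (F t + (if \<bar>t - y\<bar> \<le> 1 then d else 0))"
      by (intro ennreal_leI ex)
    moreover have "t \<in> {y - 1..y + 1} \<longleftrightarrow> \<bar>t - y\<bar> \<le> 1" by auto
    ultimately show "ennreal (g t) + ennreal (d / 2) * indicator ?W t \<le> ennreal (F t) + ennreal d * indicator {y - 1..y + 1} t"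
      using g0[of t] F0[of t] d by (auto simp: ennreal_plus indicator_def simp del: atLeastAtMost_iff split: if_splits)
  qed
  also have "\<dots> = integral\<^sup>N ?N F + ennreal d * emeasure ?N {y - 1..y + 1}"
    by (simp add: nn_integral_add nn_integral_cmult)
  also have "\<dots> \<le> integral\<^sup>N ?N F + ennreal (2 * d / 9)"
  proof (intro add_left_mono)
    have "ennreal d * emeasure ?N {y - 1..y + 1} \<le> ennreal d * ennreal (2 / 9)"
      using normal_density_interval_le[of 1 \<mu> y] by (intro mult_left_mono) auto
    also have "\<dots> = ennreal (2 * d / 9)"
      using d by (subst ennreal_mult[symmetric]) (auto simp: mult.commute)
    finally show "ennreal d * emeasure ?N {y - 1..y + 1} \<le> ennreal (2 * d / 9)" .
  qed
  finally show ?thesis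
    by (simp add: add.commute[of _ "ennreal (2 * d / 9)"] ennreal_add_left_cancel_le)
qed

section \<open>Recentring along a vector in Gaussian space\<close>

text \<open>With the l1 distance of the first \<open>n\<close> coordinates on the right,
  \<open>f\<close> depends on these coordinates alone and is continuous in the product
  topology.\<close>

definition coord_lipschitz :: "nat \<Rightarrow> ((nat \<Rightarrow> real) \<Rightarrow> real) \<Rightarrow> bool" where
  "coord_lipschitz n f \<longleftrightarrow> (\<exists>L\<ge>0. \<forall>x y. f x \<le> f y + L * (\<Sum>i<n. \<bar>x i - y i\<bar>))"

text \<open>The class in which all value functions live: it is closed under nonnegative combinations
  and under \<open>recenter\<close>, and the Lipschitz condition supplies measurability.\<close>

definition cost_fun :: "nat \<Rightarrow> ((nat \<Rightarrow> real) \<Rightarrow> real) \<Rightarrow> bool" where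
  "cost_fun n f \<longleftrightarrow> convex_on UNIV f \<and> coord_lipschitz n f \<and> (\<forall>x. 0 \<le> f x)"

text \<open>Each sublevel set of \<open>recenter f v\<close> is Banaszczyk's \<open>K * v\<close> for the sublevel set \<open>K\<close> of \<open>f\<close>:
  the part of \<open>(K + v) \<union> (K - v)\<close> on the lines along \<open>v\<close> that meet \<open>K\<close> in a chord no shorter than \<open>2 v\<close>.
  As an infimal convolution it stays convex, unlike the minimum of \<open>f (x + v)\<close> and \<open>f (x - v)\<close>.\<close>

definition recenter :: "((nat \<Rightarrow> real) \<Rightarrow> real) \<Rightarrow> (nat \<Rightarrow> real) \<Rightarrow> (nat \<Rightarrow> real) \<Rightarrow> real" where
  "recenter f v x = (INF s\<in>{-2..2}. max (f (x + (s - 1) *\<^sub>R v)) (f (x + (s + 1) *\<^sub>R v)))"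

lemma coord_lipschitz_continuous:
  assumes "coord_lipschitz n f"
  shows "continuous_on UNIV f"
proof -
  obtain L where L: "L \<ge> 0" "\<And>x y. f x \<le> f y + L * (\<Sum>i<n. \<bar>x i - y i\<bar>)"
    using assms unfolding coord_lipschitz_def by blast
  have "isCont f x" for x
  proof -
    have coord: "((\<lambda>y. y i) \<longlongrightarrow> x i) (at x)" for i
      using continuous_on_product_coordinates[of i]
      by (metis UNIV_I continuous_on_eq_continuous_at isCont_def open_UNIV)
    have "((\<lambda>y. L * (\<Sum>i<n. \<bar>y i - x i\<bar>)) \<longlongrightarrow> L * (\<Sum>i<n. \<bar>x i - x i\<bar>)) (at x)"
      by (intro tendsto_intros coord)
    then have "((\<lambda>y. L * (\<Sum>i<n. \<bar>y i - x i\<bar>)) \<longlongrightarrow> 0) (at x)" by simp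
    moreover have "\<bar>f y - f x\<bar> \<le> L * (\<Sum>i<n. \<bar>y i - x i\<bar>)" for y
      using L(2)[of x y] L(2)[of y x] by (simp add: abs_le_iff abs_minus_commute)
    ultimately have "((\<lambda>y. f y - f x) \<longlongrightarrow> 0) (at x)"
      by (intro Lim_null_comparison[of "\<lambda>y. f y - f x" "\<lambda>y. L * (\<Sum>i<n. \<bar>y i - x i\<bar>)"]) (auto simp: eventually_at_filter)
    then show ?thesis by (simp add: isCont_def LIM_zero_iff)
  qed
  then show ?thesis by (simp add: continuous_at_imp_continuous_on)
qed

lemma cost_fun_measurable:
  assumes "cost_fun n f"
  shows "f \<in> borel_measurable borel"
  using assms coord_lipschitz_continuous
  by (intro borel_measurable_continuous_onI) (auto simp: cost_fun_def)

lemma cost_fun_nonneg: "cost_fun n f \<Longrightarrow> 0 \<le> f x"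
  by (simp add: cost_fun_def)

lemma cost_fun_zero: "cost_fun n (\<lambda>_. 0)"
  by (auto simp: cost_fun_def coord_lipschitz_def convex_on_def)

lemma cost_fun_add:
  assumes "cost_fun n f" "cost_fun n g"
  shows "cost_fun n (\<lambda>x. f x + g x)"
proof -
  obtain L where L: "L \<ge> 0" "\<And>x y. f x \<le> f y + L * (\<Sum>i<n. \<bar>x i - y i\<bar>)"
    using assms unfolding cost_fun_def coord_lipschitz_def by blast
  obtain M where M: "M \<ge> 0" "\<And>x y. g x \<le> g y + M * (\<Sum>i<n. \<bar>x i - y i\<bar>)"
    using assms unfolding cost_fun_def coord_lipschitz_def by blast
  have "f x + g x \<le> f y + g y + (L + M) * (\<Sum>i<n. \<bar>x i - y i\<bar>)" for x y
    using L(2)[of x y] M(2)[of x y] by (simp add: distrib_right)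
  then have "coord_lipschitz n (\<lambda>x. f x + g x)"
    unfolding coord_lipschitz_def using L(1) M(1) by (intro exI[of _ "L + M"]) auto
  then show ?thesis
    using assms by (auto simp: cost_fun_def intro!: convex_on_add)
qed

lemma cost_fun_cmult:
  assumes "cost_fun n f" "0 \<le> c"
  shows "cost_fun n (\<lambda>x. c * f x)"
proof -
  obtain L where L: "L \<ge> 0" "\<And>x y. f x \<le> f y + L * (\<Sum>i<n. \<bar>x i - y i\<bar>)"
    using assms unfolding cost_fun_def coord_lipschitz_def by blast
  have "c * f x \<le> c * f y + (c * L) * (\<Sum>i<n. \<bar>x i - y i\<bar>)" for x y
    using mult_left_mono[OF L(2)[of x y] assms(2)] by (simp add: algebra_simps)
  then have "coord_lipschitz n (\<lambda>x. c * f x)"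
    unfolding coord_lipschitz_def using L(1) assms(2) by (intro exI[of _ "c * L"]) auto
  then show ?thesis
    using assms by (auto simp: cost_fun_def intro!: convex_on_cmul)
qed

lemma cost_fun_sum:
  "finite A \<Longrightarrow> (\<And>a. a \<in> A \<Longrightarrow> cost_fun n (f a)) \<Longrightarrow> cost_fun n (\<lambda>x. \<Sum>a\<in>A. f a x)"
  by (induction A rule: finite_induct) (auto intro: cost_fun_zero cost_fun_add)

lemma convex_on_line:
  fixes f :: "'a :: real_vector \<Rightarrow> real"
  assumes "convex_on UNIV f"
  shows "convex_on UNIV (\<lambda>t. f (x + t *\<^sub>R v))"
proof (rule convex_onI)
  fix t a b :: real assume t: "0 < t" "t < 1"
  have "x + ((1 - t) *\<^sub>R a + t *\<^sub>R b) *\<^sub>R v = (1 - t) *\<^sub>R (x + a *\<^sub>R v) + t *\<^sub>R (x + b *\<^sub>R v)"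
    by (simp add: algebra_simps)
  then show "f (x + ((1 - t) *\<^sub>R a + t *\<^sub>R b) *\<^sub>R v) \<le> (1 - t) * f (x + a *\<^sub>R v) + t * f (x + b *\<^sub>R v)"
    using convex_onD[OF assms, of t "x + a *\<^sub>R v" "x + b *\<^sub>R v"] t by simp
qed simp

lemma recenter_le:
  assumes "cost_fun n f" "\<bar>s\<bar> \<le> 2"
  shows "recenter f v x \<le> max (f (x + (s - 1) *\<^sub>R v)) (f (x + (s + 1) *\<^sub>R v))"
  unfolding recenter_def using assms
  by (intro cINF_lower bdd_belowI[of _ 0]) (auto simp: abs_le_iff le_max_iff_disj cost_fun_nonneg)

lemma recenter_attained:
  assumes "cost_fun n f"
  obtains s where "\<bar>s\<bar> \<le> 2" "recenter f v x = max (f (x + (s - 1) *\<^sub>R v)) (f (x + (s + 1) *\<^sub>R v))"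
proof -
  define h where "h s = max (f (x + (s - 1) *\<^sub>R v)) (f (x + (s + 1) *\<^sub>R v))" for s
  have line: "continuous_on UNIV (\<lambda>t. f (x + t *\<^sub>R v))"
    using assms convex_on_line[of f x v] by (intro convex_on_continuous) (auto simp: cost_fun_def)
  have "continuous_on {-2..2} (\<lambda>s. f (x + (s + c) *\<^sub>R v))" for c
    by (rule continuous_on_compose2[OF line, of "{-2..2}" "\<lambda>s. s + c"]) (auto intro!: continuous_on_add)
  from continuous_on_max[OF this[of "-1"] this[of 1]] have "continuous_on {-2..2} h"
    by (simp add: h_def)
  then obtain s where s: "s \<in> {-2..2}" "\<And>t. t \<in> {-2..2} \<Longrightarrow> h s \<le> h t"
    using continuous_attains_inf[of "{-2..2}" h] by force
  have "h s \<le> recenter f v x"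
    unfolding recenter_def h_def[symmetric] using s by (intro cINF_greatest) auto
  moreover have "recenter f v x \<le> h s"
    using recenter_le[OF assms, of s v x] s by (auto simp: h_def)
  ultimately show thesis using that[of s] s(1) by (auto simp: h_def)
qed

text \<open>This fixes the range of the shift: for \<open>\<bar>s\<bar> \<le> 2\<close> the segment
  from \<open>s - 1\<close> to \<open>s + 1\<close> contains 1 or -1, and on a segment a convex
  function is at most its larger endpoint value. Hence one of the two signs achieves the recentred
  value.\<close>

lemma recenter_ge_min:
  assumes "cost_fun n f"
  shows "min (f (x + v)) (f (x - v)) \<le> recenter f v x"
proof -
  obtain s where s: "\<bar>s\<bar> \<le> 2" "recenter f v x = max (f (x + (s - 1) *\<^sub>R v)) (f (x + (s + 1) *\<^sub>R v))"
    using recenter_attained[OF assms] .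
  define F where "F t = f (x + t *\<^sub>R v)" for t
  have F: "convex_on UNIV F"
    using assms convex_on_line unfolding F_def cost_fun_def by blast
  have seg: "F t \<le> max (F (s - 1)) (F (s + 1))" if "s - 1 \<le> t" "t \<le> s + 1" for t
  proof -
    have "2 * F t \<le> (s + 1 - t) * F (s - 1) + (t - (s - 1)) * F (s + 1)"
      using convex_on_three_points[OF F, of "s - 1" t "s + 1"] that by simp
    also have "\<dots> \<le> (s + 1 - t) * max (F (s - 1)) (F (s + 1)) + (t - (s - 1)) * max (F (s - 1)) (F (s + 1))"
      using that by (intro add_mono mult_left_mono) auto
    also have "\<dots> = 2 * max (F (s - 1)) (F (s + 1))" by (simp add: algebra_simps)
    finally show ?thesis by simp
  qed
  show ?thesis
    using seg[of 1] seg[of "-1"] s by (cases "s \<ge> 0") (auto simp: F_def)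
qed

text \<open>The maximum is jointly convex in point and shift, so minimising over an interval of
  shifts preserves convexity: the combination of two optimal shifts serves the combined point. The
  Lipschitz constant survives because the optimal shift of one point may be used at the
  other.\<close>

lemma cost_fun_recenter:
  assumes f: "cost_fun n f"
  shows "cost_fun n (recenter f v)"
proof -
  have "convex_on UNIV (recenter f v)"
  proof (rule convex_onI)
    fix t :: real and x y assume t: "0 < t" "t < 1"
    obtain r where r: "\<bar>r\<bar> \<le> 2" "recenter f v x = max (f (x + (r - 1) *\<^sub>R v)) (f (x + (r + 1) *\<^sub>R v))"
      using recenter_attained[OF f] .
    obtain s where s: "\<bar>s\<bar> \<le> 2" "recenter f v y = max (f (y + (s - 1) *\<^sub>R v)) (f (y + (s + 1) *\<^sub>R v))"
      using recenter_attained[OF f] .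
    define q where "q = (1 - t) * r + t * s"
    have q: "\<bar>q\<bar> \<le> 2"
      unfolding q_def using convex_bound_le[of r 2 s "1 - t" t] convex_bound_le[of "- r" 2 "- s" "1 - t" t] r(1) s(1) t
      by (auto simp: abs_le_iff)
    have *: "f ((1 - t) *\<^sub>R x + t *\<^sub>R y + (q + c) *\<^sub>R v) \<le> (1 - t) * f (x + (r + c) *\<^sub>R v) + t * f (y + (s + c) *\<^sub>R v)" for c
    proof -
      have "(1 - t) *\<^sub>R x + t *\<^sub>R y + (q + c) *\<^sub>R v = (1 - t) *\<^sub>R (x + (r + c) *\<^sub>R v) + t *\<^sub>R (y + (s + c) *\<^sub>R v)"
        by (simp add: q_def algebra_simps)
      then show ?thesis
        using f t convex_onD[of UNIV f t "x + (r + c) *\<^sub>R v" "y + (s + c) *\<^sub>R v"] by (simp add: cost_fun_def)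
    qed
    have "recenter f v ((1 - t) *\<^sub>R x + t *\<^sub>R y)
        \<le> max (f ((1 - t) *\<^sub>R x + t *\<^sub>R y + (q + (-1)) *\<^sub>R v)) (f ((1 - t) *\<^sub>R x + t *\<^sub>R y + (q + 1) *\<^sub>R v))"
      using recenter_le[OF f q, of v "(1 - t) *\<^sub>R x + t *\<^sub>R y"] by simp
    also have "\<dots> \<le> (1 - t) * recenter f v x + t * recenter f v y"
    proof (rule max.boundedI; rule order_trans[OF *]; rule add_mono; rule mult_left_mono)
    qed (use t r s in auto)
    finally show "recenter f v ((1 - t) *\<^sub>R x + t *\<^sub>R y) \<le> (1 - t) * recenter f v x + t * recenter f v y" .
  qed simp
  moreover have "coord_lipschitz n (recenter f v)"
  proof -
    obtain L where L: "L \<ge> 0" "\<And>x y. f x \<le> f y + L * (\<Sum>i<n. \<bar>x i - y i\<bar>)"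
      using f unfolding cost_fun_def coord_lipschitz_def by blast
    have "recenter f v x \<le> recenter f v y + L * (\<Sum>i<n. \<bar>x i - y i\<bar>)" for x y
    proof -
      obtain s where s: "\<bar>s\<bar> \<le> 2" "recenter f v y = max (f (y + (s - 1) *\<^sub>R v)) (f (y + (s + 1) *\<^sub>R v))"
        using recenter_attained[OF f] .
      have "recenter f v x \<le> max (f (x + (s - 1) *\<^sub>R v)) (f (x + (s + 1) *\<^sub>R v))"
        by (rule recenter_le[OF f s(1)])
      also have "\<dots> \<le> max (f (y + (s - 1) *\<^sub>R v)) (f (y + (s + 1) *\<^sub>R v)) + L * (\<Sum>i<n. \<bar>x i - y i\<bar>)"
        using L(2)[of "x + (s - 1) *\<^sub>R v" "y + (s - 1) *\<^sub>R v"] L(2)[of "x + (s + 1) *\<^sub>R v" "y + (s + 1) *\<^sub>R v"]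
        by (simp add: max_def)
      finally show ?thesis by (simp add: s)
    qed
    then show ?thesis using L(1) unfolding coord_lipschitz_def by blast
  qed
  moreover have "0 \<le> recenter f v x" for x
    using recenter_ge_min[OF f, of x v] cost_fun_nonneg[OF f, of "x + v"] cost_fun_nonneg[OF f, of "x - v"] by linarith
  ultimately show ?thesis by (simp add: cost_fun_def)
qed

section \<open>Coordinate splitting and translations of the Gaussian measure\<close>

declare sets_gaussian_measure [measurable_cong]

lemma measurable_fun_upd_borel [measurable]:
  "(\<lambda>(x, s). x(k := s)) \<in> borel \<Otimes>\<^sub>M borel \<rightarrow>\<^sub>M (borel :: (nat \<Rightarrow> real) measure)"
proof (rule measurable_coordinatewise_then_product)
  fix i show "(\<lambda>p. (case p of (x, s) \<Rightarrow> x(k := s)) i) \<in> borel_measurable (borel \<Otimes>\<^sub>M (borel :: real measure))"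
    by (cases "i = k") (auto simp: case_prod_beta intro!: measurable_compose[OF measurable_fst] measurable_product_coordinates)
qed

lemma measurable_add_scaleR_borel [measurable]:
  "(\<lambda>(t, x). x + t *\<^sub>R v) \<in> borel \<Otimes>\<^sub>M borel \<rightarrow>\<^sub>M (borel :: (nat \<Rightarrow> real) measure)"
proof (rule measurable_coordinatewise_then_product)
  fix i
  have [measurable]: "(\<lambda>p. snd p i) \<in> borel_measurable (borel \<Otimes>\<^sub>M (borel :: (nat \<Rightarrow> real) measure))"
    by (rule measurable_compose[OF measurable_snd measurable_product_coordinates])
  show "(\<lambda>p. (case p of (t, x) \<Rightarrow> x + t *\<^sub>R v) i) \<in> borel_measurable ((borel :: real measure) \<Otimes>\<^sub>M borel)"
    by (simp add: case_prod_beta)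
qed

text \<open>Fubini for the last coordinate, the device behind all inductions on the dimension:
  \<open>x(n := s)\<close> overwrites the 0 that \<open>zero_extend\<close> leaves at index
  \<open>n\<close>.\<close>

lemma nn_integral_gaussian_Suc:
  assumes [measurable]: "F \<in> borel_measurable borel"
  shows "(\<integral>\<^sup>+x. F x \<partial>gaussian_measure (Suc n))
    = (\<integral>\<^sup>+x. \<integral>\<^sup>+s. F (x(n := s)) \<partial>std_normal_distribution \<partial>gaussian_measure n)"
proof -
  interpret product_sigma_finite "\<lambda>_. std_normal_distribution"
    by (intro product_sigma_finite.intro prob_space_imp_sigma_finite prob_space_normal_density) simp
  interpret N: prob_space std_normal_distribution by (rule prob_space_normal_density) simp
  have ext: "zero_extend (Suc n) (x(n := s)) = (zero_extend n x)(n := s)" for x s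
    by (auto simp: zero_extend_def fun_eq_iff)
  have m: "(\<lambda>x. F (zero_extend (Suc n) x)) \<in> borel_measurable (\<Pi>\<^sub>M i\<in>insert n {..<n}. std_normal_distribution)"
    using measurable_compose[OF measurable_zero_extend assms, of "Suc n"] by (simp add: lessThan_Suc)
  have "(\<integral>\<^sup>+x. F x \<partial>gaussian_measure (Suc n))
      = (\<integral>\<^sup>+x. F (zero_extend (Suc n) x) \<partial>(\<Pi>\<^sub>M i\<in>insert n {..<n}. std_normal_distribution))"
    unfolding gaussian_measure_def using measurable_zero_extend[of "Suc n"]
    by (subst nn_integral_distr) (simp_all add: lessThan_Suc)
  also have "\<dots> = (\<integral>\<^sup>+x. \<integral>\<^sup>+s. F (zero_extend (Suc n) (x(n := s))) \<partial>std_normal_distribution \<partial>(\<Pi>\<^sub>M i\<in>{..<n}. std_normal_distribution))"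
    by (rule product_nn_integral_insert[OF _ _ m]) auto
  also have "\<dots> = (\<integral>\<^sup>+x. \<integral>\<^sup>+s. F (x(n := s)) \<partial>std_normal_distribution \<partial>gaussian_measure n)"
    unfolding gaussian_measure_def ext by (subst nn_integral_distr) auto
  finally show ?thesis .
qed

lemma nn_integral_gaussian_0:
  assumes [measurable]: "F \<in> borel_measurable borel"
  shows "(\<integral>\<^sup>+x. F x \<partial>gaussian_measure 0) = F 0"
proof -
  have "(\<integral>\<^sup>+x. F x \<partial>gaussian_measure 0) = (\<integral>\<^sup>+x. F (zero_extend 0 x) \<partial>(\<Pi>\<^sub>M i\<in>{..<0::nat}. std_normal_distribution))"
    unfolding gaussian_measure_def by (rule nn_integral_distr[OF measurable_zero_extend]) simp
  also have "\<dots> = F 0"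
    by (simp add: PiM_empty nn_integral_count_space_finite zero_extend_def zero_fun_def)
  finally show ?thesis .
qed

lemma nn_integral_std_normal_shift:
  assumes [measurable]: "f \<in> borel_measurable borel"
  shows "(\<integral>\<^sup>+s. f s \<partial>std_normal_distribution)
    = (\<integral>\<^sup>+s. f (s + a) * ennreal (exp (- (s * a) - a\<^sup>2 / 2)) \<partial>std_normal_distribution)"
proof -
  have "std_normal_density (a + s) = exp (- (s * a) - a\<^sup>2 / 2) * std_normal_density s" for s
    by (simp add: std_normal_density_def exp_add[symmetric] power2_eq_square field_simps)
  then have *: "ennreal (std_normal_density (a + s)) = ennreal (std_normal_density s) * ennreal (exp (- (s * a) - a\<^sup>2 / 2))" for s
    by (simp add: mult.commute flip: ennreal_mult)
  have "(\<integral>\<^sup>+s. f s \<partial>std_normal_distribution) = (\<integral>\<^sup>+s. ennreal (std_normal_density s) * f s \<partial>lborel)"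
    by (simp add: nn_integral_density)
  also have "\<dots> = (\<integral>\<^sup>+s. ennreal (std_normal_density (a + s)) * f (a + s) \<partial>lborel)"
    using nn_integral_real_affine[of "\<lambda>s. ennreal (std_normal_density s) * f s" 1 a] by simp
  also have "\<dots> = (\<integral>\<^sup>+s. f (s + a) * ennreal (exp (- (s * a) - a\<^sup>2 / 2)) \<partial>std_normal_distribution)"
    unfolding * by (simp add: nn_integral_density ac_simps)
  finally show ?thesis .
qed

text \<open>The Cameron-Martin formula. Its density factorises over the coordinates, so the
  one-dimensional shift handles the last coordinate and the induction hypothesis the others.\<close>

lemma nn_integral_gaussian_shift:
  assumes "F \<in> borel_measurable borel" "\<And>i. n \<le> i \<Longrightarrow> v i = 0"
  shows "(\<integral>\<^sup>+x. F x \<partial>gaussian_measure n)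
    = (\<integral>\<^sup>+x. F (x + v) * ennreal (exp (- (\<Sum>i<n. x i * v i) - (\<Sum>i<n. (v i)\<^sup>2) / 2)) \<partial>gaussian_measure n)"
  using assms
proof (induction n arbitrary: F v)
  case 0
  then have "v = 0" by (auto simp: fun_eq_iff)
  then show ?case by (simp add: nn_integral_gaussian_0 0)
next
  case (Suc n)
  note [measurable] = Suc.prems(1)
  define w where "w = v(n := 0)"
  define E where "E x = ennreal (exp (- (\<Sum>i<n. x i * w i) - (\<Sum>i<n. (w i)\<^sup>2) / 2))" for x
  interpret N: prob_space std_normal_distribution by (rule prob_space_normal_density) simp
  have addw [measurable]: "(\<lambda>x. x + w) \<in> borel \<rightarrow>\<^sub>M borel" "(\<lambda>x. x + v) \<in> borel \<rightarrow>\<^sub>M borel"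
    using measurable_compose[OF measurable_Pair[of "\<lambda>_. 1" _ _ "\<lambda>x. x"] measurable_add_scaleR_borel] by simp_all
  have [measurable]: "(\<lambda>x :: nat \<Rightarrow> real. x i) \<in> borel_measurable borel" for i
    by (rule measurable_product_coordinates)
  have "(\<integral>\<^sup>+x. F x \<partial>gaussian_measure (Suc n))
      = (\<integral>\<^sup>+x. (\<integral>\<^sup>+s. F ((x + w)(n := s)) \<partial>std_normal_distribution) * E x \<partial>gaussian_measure n)"
    unfolding E_def
    by (subst nn_integral_gaussian_Suc, measurable, subst Suc.IH[where v = w]) (auto simp: w_def Suc.prems)
  also have "\<dots> = (\<integral>\<^sup>+x. (\<integral>\<^sup>+s. F ((x + w)(n := s + v n)) * ennreal (exp (- (s * v n) - (v n)\<^sup>2 / 2)) \<partial>std_normal_distribution) * E x \<partial>gaussian_measure n)"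
    by (subst nn_integral_std_normal_shift[where a = "v n"]) auto
  also have "\<dots> = (\<integral>\<^sup>+x. \<integral>\<^sup>+s. F (x(n := s) + v) * ennreal (exp (- (\<Sum>i<Suc n. (x(n := s)) i * v i) - (\<Sum>i<Suc n. (v i)\<^sup>2) / 2)) \<partial>std_normal_distribution \<partial>gaussian_measure n)"
  proof (intro nn_integral_cong)
    fix x :: "nat \<Rightarrow> real"
    have 1: "(x + w)(n := s + v n) = x(n := s) + v" for s
      by (auto simp: w_def fun_eq_iff)
    have 2: "ennreal (exp (- (\<Sum>i<Suc n. (x(n := s)) i * v i) - (\<Sum>i<Suc n. (v i)\<^sup>2) / 2))
        = ennreal (exp (- (s * v n) - (v n)\<^sup>2 / 2)) * E x" for s
      by (simp add: E_def w_def algebra_simps add_divide_distrib flip: ennreal_mult exp_add)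
    show "(\<integral>\<^sup>+s. F ((x + w)(n := s + v n)) * ennreal (exp (- (s * v n) - (v n)\<^sup>2 / 2)) \<partial>std_normal_distribution) * E x
        = (\<integral>\<^sup>+s. F (x(n := s) + v) * ennreal (exp (- (\<Sum>i<Suc n. (x(n := s)) i * v i) - (\<Sum>i<Suc n. (v i)\<^sup>2) / 2)) \<partial>std_normal_distribution)"
      unfolding 1 2 by (simp add: nn_integral_multc[symmetric] mult.assoc)
  qed
  also have "\<dots> = (\<integral>\<^sup>+x. F (x + v) * ennreal (exp (- (\<Sum>i<Suc n. x i * v i) - (\<Sum>i<Suc n. (v i)\<^sup>2) / 2)) \<partial>gaussian_measure (Suc n))"
    by (rule nn_integral_gaussian_Suc[symmetric]) measurable
  finally show ?case .
qed

text \<open>Averaging the shift formula over all multiples of \<open>v\<close>, with a centred normal weight chosen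
  such that every line along \<open>v\<close> carries a normal distribution of standard deviation 4.\<close>

lemma nn_integral_gaussian_lines:
  assumes v: "\<And>i. n \<le> i \<Longrightarrow> v i = 0" "(\<Sum>i<n. (v i)\<^sup>2) \<le> 1 / 64"
  obtains W \<mu> where "\<And>F. F \<in> borel_measurable borel \<Longrightarrow> (\<integral>\<^sup>+x. F x \<partial>gaussian_measure n)
    = (\<integral>\<^sup>+x. W x * (\<integral>\<^sup>+t. F (x + t *\<^sub>R v) \<partial>density lborel (normal_density (\<mu> x) 4)) \<partial>gaussian_measure n)"
proof -
  define a where "a = (\<Sum>i<n. (v i)\<^sup>2)"
  define b where "b x = (\<Sum>i<n. x i * v i)" for x
  \<comment> \<open>\<open>p\<close> is the inverse variance of the weight on the multiples
    \<open>t\<close> of \<open>v\<close>. The shift formula adds \<open>a\<close> to the coefficient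
    of \<open>- t\<^sup>2 / 2\<close>, and \<open>p + a = 1 / 16\<close> leaves variance 16 whatever
    the length of \<open>v\<close>. Completing the square yields the mean \<open>- 16 * b x\<close>
    and a factor without \<open>t\<close>, which goes into \<open>W\<close>.\<close>
  define p where "p = 1 / 16 - a"
  define \<tau> where "\<tau> = 1 / sqrt p"
  have p: "p > 0" using v(2) by (simp add: p_def a_def)
  define W where "W x = ennreal (sqrt (32 * pi) / sqrt (2 * pi * \<tau>\<^sup>2) * exp (8 * (b x)\<^sup>2))" for x
  interpret \<gamma>: prob_space "gaussian_measure n" by (rule prob_space_gaussian_measure)
  have [measurable]: "(\<lambda>x :: nat \<Rightarrow> real. x i) \<in> borel_measurable borel" for i
    by (rule measurable_product_coordinates)
  have [measurable]: "b \<in> borel_measurable borel" unfolding b_def by measurable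
  have \<tau>: "\<tau> > 0" "\<tau>\<^sup>2 = 1 / p" using p by (auto simp: \<tau>_def power_divide)
  have dens: "ennreal (normal_density 0 \<tau> t) * ennreal (exp (- (t * b x) - t\<^sup>2 * a / 2))
      = W x * ennreal (normal_density (- 16 * b x) 4 t)" for t x
  proof -
    have "- t\<^sup>2 * p / 2 + (- (t * b x) - t\<^sup>2 * a / 2) = 8 * (b x)\<^sup>2 + (- (t - - 16 * b x)\<^sup>2 / 32)"
      by (simp add: p_def power2_eq_square field_simps)
    then have "exp (- t\<^sup>2 * p / 2) * exp (- (t * b x) - t\<^sup>2 * a / 2) = exp (8 * (b x)\<^sup>2) * exp (- (t - - 16 * b x)\<^sup>2 / 32)"
      by (simp only: exp_add[symmetric])
    then have "normal_density 0 \<tau> t * exp (- (t * b x) - t\<^sup>2 * a / 2)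
        = sqrt (32 * pi) / sqrt (2 * pi * \<tau>\<^sup>2) * exp (8 * (b x)\<^sup>2) * normal_density (- 16 * b x) 4 t"
      by (simp add: normal_density_def \<tau>(2) mult.commute)
    then show ?thesis
      unfolding W_def by (simp flip: ennreal_mult)
  qed
  have "(\<integral>\<^sup>+x. F x \<partial>gaussian_measure n)
    = (\<integral>\<^sup>+x. W x * (\<integral>\<^sup>+t. F (x + t *\<^sub>R v) \<partial>density lborel (normal_density (- 16 * b x) 4)) \<partial>gaussian_measure n)"
    if F [measurable]: "F \<in> borel_measurable borel" for F
  proof -
    interpret P: prob_space "density lborel (normal_density 0 \<tau>)"
      by (rule prob_space_normal_density[OF \<tau>(1)])
    interpret pair_sigma_finite lborel "gaussian_measure n" ..
    have "(\<integral>\<^sup>+x. F x \<partial>gaussian_measure n) = (\<integral>\<^sup>+t. (\<integral>\<^sup>+x. F x \<partial>gaussian_measure n) \<partial>density lborel (normal_density 0 \<tau>))"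
      using P.emeasure_space_1 by (simp add: nn_integral_const)
    also have "\<dots> = (\<integral>\<^sup>+t. ennreal (normal_density 0 \<tau> t) * (\<integral>\<^sup>+x. F x \<partial>gaussian_measure n) \<partial>lborel)"
      by (subst nn_integral_density) simp_all
    also have "\<dots> = (\<integral>\<^sup>+t. (\<integral>\<^sup>+x. F (x + t *\<^sub>R v) * (W x * ennreal (normal_density (- 16 * b x) 4 t)) \<partial>gaussian_measure n) \<partial>lborel)"
    proof (intro nn_integral_cong)
      fix t :: real
      have [measurable]: "(\<lambda>x. x + t *\<^sub>R v) \<in> borel \<rightarrow>\<^sub>M borel"
        using measurable_compose[OF measurable_Pair[of "\<lambda>_. t" _ _ "\<lambda>x. x"] measurable_add_scaleR_borel] by simp
      have "(\<integral>\<^sup>+x. F x \<partial>gaussian_measure n) = (\<integral>\<^sup>+x. F (x + t *\<^sub>R v) * ennreal (exp (- (t * b x) - t\<^sup>2 * a / 2)) \<partial>gaussian_measure n)"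
        using v(1) by (subst nn_integral_gaussian_shift[OF F, of n "t *\<^sub>R v"])
          (simp_all add: a_def b_def sum_distrib_left power_mult_distrib ac_simps)
      then show "ennreal (normal_density 0 \<tau> t) * (\<integral>\<^sup>+x. F x \<partial>gaussian_measure n)
          = (\<integral>\<^sup>+x. F (x + t *\<^sub>R v) * (W x * ennreal (normal_density (- 16 * b x) 4 t)) \<partial>gaussian_measure n)"
        by (simp only: dens[symmetric], subst nn_integral_cmult[symmetric]) (simp_all add: mult.left_commute)
    qed
    also have "\<dots> = (\<integral>\<^sup>+x. (\<integral>\<^sup>+t. F (x + t *\<^sub>R v) * (W x * ennreal (normal_density (- 16 * b x) 4 t)) \<partial>lborel) \<partial>gaussian_measure n)"
      unfolding W_def normal_density_def by (rule Fubini'[symmetric], unfold case_prod_beta) measurable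
    also have "\<dots> = (\<integral>\<^sup>+x. W x * (\<integral>\<^sup>+t. F (x + t *\<^sub>R v) \<partial>density lborel (normal_density (- 16 * b x) 4)) \<partial>gaussian_measure n)"
    proof (intro nn_integral_cong)
      fix x
      have [measurable]: "(\<lambda>t. x + t *\<^sub>R v) \<in> borel \<rightarrow>\<^sub>M borel"
        using measurable_compose[OF measurable_Pair[of "\<lambda>t. t" _ _ "\<lambda>_. x"] measurable_add_scaleR_borel] by simp
      show "(\<integral>\<^sup>+t. F (x + t *\<^sub>R v) * (W x * ennreal (normal_density (- 16 * b x) 4 t)) \<partial>lborel)
          = W x * (\<integral>\<^sup>+t. F (x + t *\<^sub>R v) \<partial>density lborel (normal_density (- 16 * b x) 4))"
        by (simp add: nn_integral_density nn_integral_cmult[symmetric] ac_simps)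
    qed
    finally show ?thesis .
  qed
  then show thesis using that[of W "\<lambda>x. - 16 * b x"] by blast
qed

text \<open>Weight and means in the decomposition into lines do not depend on the integrated
  function, so both integrals can be compared line by line. On a line, a shift by \<open>s\<close>
  at parameter \<open>t\<close> is the window around \<open>t + s\<close>.\<close>

lemma nn_integral_recenter_le:
  assumes f: "cost_fun n f" and v: "\<And>i. n \<le> i \<Longrightarrow> v i = 0" "(\<Sum>i<n. (v i)\<^sup>2) \<le> 1 / 64"
  shows "(\<integral>\<^sup>+x. recenter f v x \<partial>gaussian_measure n) \<le> (\<integral>\<^sup>+x. f x \<partial>gaussian_measure n)"
proof -
  note g = cost_fun_recenter[OF f, of v]
  note [measurable] = cost_fun_measurable[OF f] cost_fun_measurable[OF g]
  obtain W \<mu> where W: "\<And>F. F \<in> borel_measurable borel \<Longrightarrow> (\<integral>\<^sup>+x. F x \<partial>gaussian_measure n)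
    = (\<integral>\<^sup>+x. W x * (\<integral>\<^sup>+t. F (x + t *\<^sub>R v) \<partial>density lborel (normal_density (\<mu> x) 4)) \<partial>gaussian_measure n)"
    using nn_integral_gaussian_lines[OF v] by blast
  have "(\<integral>\<^sup>+t. recenter f v (x + t *\<^sub>R v) \<partial>density lborel (normal_density (\<mu> x) 4))
      \<le> (\<integral>\<^sup>+t. f (x + t *\<^sub>R v) \<partial>density lborel (normal_density (\<mu> x) 4))" for x
  proof (rule nn_integral_convex_window_le)
    have line: "convex_on UNIV (\<lambda>t. h (x + t *\<^sub>R v))" if "cost_fun n h" for h
      using that convex_on_line by (auto simp: cost_fun_def)
    show "convex_on UNIV (\<lambda>t. f (x + t *\<^sub>R v))" by (rule line[OF f])
    show "(\<lambda>t. recenter f v (x + t *\<^sub>R v)) \<in> borel_measurable borel"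
      by (intro borel_measurable_continuous_onI convex_on_continuous line[OF g]) simp
    fix t s :: real assume "\<bar>s\<bar> \<le> 2"
    then show "recenter f v (x + t *\<^sub>R v) \<le> max (f (x + (t + s - 1) *\<^sub>R v)) (f (x + (t + s + 1) *\<^sub>R v))"
      using recenter_le[OF f, of s v "x + t *\<^sub>R v"] by (simp add: algebra_simps)
  qed (use f g in \<open>auto simp: cost_fun_nonneg\<close>)
  then show ?thesis
    by (subst (1 2) W) (simp_all add: nn_integral_mono mult_left_mono)
qed

section \<open>Gaussian symmetries and tails of seminorms\<close>

lemma nn_integral_std_normal_uminus:
  assumes [measurable]: "f \<in> borel_measurable borel"
  shows "(\<integral>\<^sup>+s. f (- s) \<partial>std_normal_distribution) = (\<integral>\<^sup>+s. f s \<partial>std_normal_distribution)"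
proof -
  have "(\<integral>\<^sup>+s. f s \<partial>std_normal_distribution) = (\<integral>\<^sup>+s. ennreal (std_normal_density s) * f s \<partial>lborel)"
    by (subst nn_integral_density) simp_all
  also have "\<dots> = (\<integral>\<^sup>+s. ennreal (std_normal_density s) * f (- s) \<partial>lborel)"
    using nn_integral_real_affine[of "\<lambda>s. ennreal (std_normal_density s) * f s" "-1" 0]
    by (simp add: std_normal_density_def)
  also have "\<dots> = (\<integral>\<^sup>+s. f (- s) \<partial>std_normal_distribution)"
    by (subst nn_integral_density) simp_all
  finally show ?thesis by simp
qed

lemma measurable_uminus_fun_borel [measurable]:
  "uminus \<in> borel \<rightarrow>\<^sub>M (borel :: (nat \<Rightarrow> real) measure)"
proof (rule measurable_coordinatewise_then_product)
  fix i
  have [measurable]: "(\<lambda>x :: nat \<Rightarrow> real. x i) \<in> borel_measurable borel"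
    by (rule measurable_product_coordinates)
  show "(\<lambda>x :: nat \<Rightarrow> real. (- x) i) \<in> borel_measurable borel" by simp
qed

lemma nn_integral_gaussian_uminus:
  assumes "F \<in> borel_measurable borel"
  shows "(\<integral>\<^sup>+x. F (- x) \<partial>gaussian_measure n) = (\<integral>\<^sup>+x. F x \<partial>gaussian_measure n)"
  using assms
proof (induction n arbitrary: F)
  case 0
  then show ?case
    by (subst (1 2) nn_integral_gaussian_0) (auto intro: measurable_compose[OF measurable_uminus_fun_borel])
next
  case (Suc n)
  note [measurable] = Suc.prems
  interpret N: prob_space std_normal_distribution by (rule prob_space_normal_density) simp
  have "(\<integral>\<^sup>+x. F (- x) \<partial>gaussian_measure (Suc n))
      = (\<integral>\<^sup>+x. \<integral>\<^sup>+s. F (- (x(n := s))) \<partial>std_normal_distribution \<partial>gaussian_measure n)"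
    by (rule nn_integral_gaussian_Suc) measurable
  also have "\<dots> = (\<integral>\<^sup>+x. \<integral>\<^sup>+s. F ((- x)(n := - s)) \<partial>std_normal_distribution \<partial>gaussian_measure n)"
  proof -
    have "- (x(n := s)) = (- x)(n := - s)" for x :: "nat \<Rightarrow> real" and s by (auto simp: fun_eq_iff)
    then show ?thesis by simp
  qed
  also have "\<dots> = (\<integral>\<^sup>+x. \<integral>\<^sup>+s. F ((- x)(n := s)) \<partial>std_normal_distribution \<partial>gaussian_measure n)"
    by (subst nn_integral_std_normal_uminus[where f = "\<lambda>s. F ((- x)(n := s))" for x]) auto
  also have "\<dots> = (\<integral>\<^sup>+x. \<integral>\<^sup>+s. F (x(n := s)) \<partial>std_normal_distribution \<partial>gaussian_measure n)"
    by (rule Suc.IH) measurable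
  also have "\<dots> = (\<integral>\<^sup>+x. F x \<partial>gaussian_measure (Suc n))"
    by (rule nn_integral_gaussian_Suc[symmetric]) measurable
  finally show ?case .
qed

text \<open>Jensen's inequality at the centre of symmetry, by averaging \<open>f x\<close> and
  \<open>f (- x)\<close>. It turns a bound on the Gaussian mean of a value function into one at the
  starting position.\<close>

lemma cost_fun_0_le_nn_integral:
  assumes f: "cost_fun n f"
  shows "ennreal (f 0) \<le> (\<integral>\<^sup>+x. f x \<partial>gaussian_measure n)"
proof -
  interpret prob_space "gaussian_measure n" by (rule prob_space_gaussian_measure)
  note [measurable] = cost_fun_measurable[OF f]
  note f0 = cost_fun_nonneg[OF f]
  have 1: "2 * f 0 \<le> f x + f (- x)" for x
  proof -
    have "(1 - 1 / 2) *\<^sub>R x + (1 / 2 :: real) *\<^sub>R (- x) = 0" by (simp add: fun_eq_iff)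
    then show ?thesis
      using f convex_onD[of UNIV f "1 / 2" x "- x"] by (simp add: cost_fun_def)
  qed
  have "2 * ennreal (f 0) = ennreal (2 * f 0)"
    using f0[of 0] by (simp add: ennreal_mult)
  also have "\<dots> = (\<integral>\<^sup>+x. ennreal (2 * f 0) \<partial>gaussian_measure n)"
    using emeasure_space_1 by simp
  also have "\<dots> \<le> (\<integral>\<^sup>+x. ennreal (f x) + ennreal (f (- x)) \<partial>gaussian_measure n)"
    by (intro nn_integral_mono) (auto simp: f0 1 simp flip: ennreal_plus intro!: ennreal_leI)
  also have "\<dots> = 2 * (\<integral>\<^sup>+x. f x \<partial>gaussian_measure n)"
    by (subst nn_integral_add) (simp_all add: nn_integral_gaussian_uminus[of "\<lambda>x. ennreal (f x)"] mult_2)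
  finally show ?thesis
    by (simp add: ennreal_mult_le_mult_iff)
qed

text \<open>Two affine substitutions in one variable, with an exchange of the integrals between
  them: \<open>a = (s + r) / sqrt 2\<close> for fixed \<open>s\<close>, then
  \<open>b = sqrt 2 * s - a\<close> for fixed \<open>a\<close>. The factors \<open>sqrt 2\<close>
  and \<open>1 / sqrt 2\<close> cancel, and the product density depends only on the sum of
  squares.\<close>

lemma nn_integral_std_normal_rotate:
  fixes H :: "real \<Rightarrow> real \<Rightarrow> ennreal"
  assumes [measurable]: "case_prod H \<in> borel_measurable (borel \<Otimes>\<^sub>M borel)"
  shows "(\<integral>\<^sup>+s. \<integral>\<^sup>+r. H ((s + r) / sqrt 2) ((s - r) / sqrt 2) \<partial>std_normal_distribution \<partial>std_normal_distribution)
    = (\<integral>\<^sup>+s. \<integral>\<^sup>+r. H s r \<partial>std_normal_distribution \<partial>std_normal_distribution)"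
proof -
  let ?n = "\<lambda>s. ennreal (std_normal_density s)"
  interpret N: prob_space std_normal_distribution by (rule prob_space_normal_density) simp
  have rot: "?n ((a + b) / sqrt 2) * ?n ((a - b) / sqrt 2) = ?n a * ?n b" for a b
  proof -
    have "- ((a + b) / sqrt 2)\<^sup>2 / 2 + - ((a - b) / sqrt 2)\<^sup>2 / 2 = - a\<^sup>2 / 2 + - b\<^sup>2 / 2"
      by (simp add: power_divide field_simps power2_eq_square)
    then have "exp (- ((a + b) / sqrt 2)\<^sup>2 / 2) * exp (- ((a - b) / sqrt 2)\<^sup>2 / 2) = exp (- a\<^sup>2 / 2) * exp (- b\<^sup>2 / 2)"
      by (simp only: exp_add[symmetric])
    then show ?thesis
      by (simp add: std_normal_density_def flip: ennreal_mult)
  qed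
  have dens: "(\<integral>\<^sup>+s. \<integral>\<^sup>+r. G s r \<partial>std_normal_distribution \<partial>std_normal_distribution)
      = (\<integral>\<^sup>+s. \<integral>\<^sup>+r. ?n s * ?n r * G s r \<partial>lborel \<partial>lborel)"
    if [measurable]: "case_prod G \<in> borel_measurable (borel \<Otimes>\<^sub>M borel)" for G :: "real \<Rightarrow> real \<Rightarrow> ennreal"
    by (simp add: nn_integral_density nn_integral_cmult[symmetric] mult.assoc)
  have "(\<integral>\<^sup>+s. \<integral>\<^sup>+r. H ((s + r) / sqrt 2) ((s - r) / sqrt 2) \<partial>std_normal_distribution \<partial>std_normal_distribution)
      = (\<integral>\<^sup>+s. \<integral>\<^sup>+r. ?n s * ?n r * H ((s + r) / sqrt 2) ((s - r) / sqrt 2) \<partial>lborel \<partial>lborel)"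
    by (rule dens) measurable
  also have "\<dots> = (\<integral>\<^sup>+s. ennreal (sqrt 2) * (\<integral>\<^sup>+a. ?n s * ?n (sqrt 2 * a - s) * H a (sqrt 2 * s - a) \<partial>lborel) \<partial>lborel)"
  proof (intro nn_integral_cong)
    fix s :: real
    have e: "(s - (- s + sqrt 2 * a)) / sqrt 2 = sqrt 2 * s - a" "(s + (- s + sqrt 2 * a)) / sqrt 2 = a" for a
      by (simp_all add: field_simps)
    show "(\<integral>\<^sup>+r. ?n s * ?n r * H ((s + r) / sqrt 2) ((s - r) / sqrt 2) \<partial>lborel)
        = ennreal (sqrt 2) * (\<integral>\<^sup>+a. ?n s * ?n (sqrt 2 * a - s) * H a (sqrt 2 * s - a) \<partial>lborel)"
      by (subst nn_integral_real_affine[where c = "sqrt 2" and t = "- s"]) (simp_all only: e, simp_all)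
  qed
  also have "\<dots> = (\<integral>\<^sup>+s. \<integral>\<^sup>+a. ennreal (sqrt 2) * (?n s * ?n (sqrt 2 * a - s) * H a (sqrt 2 * s - a)) \<partial>lborel \<partial>lborel)"
    by (simp add: nn_integral_cmult)
  also have "\<dots> = (\<integral>\<^sup>+a. \<integral>\<^sup>+s. ennreal (sqrt 2) * (?n s * ?n (sqrt 2 * a - s) * H a (sqrt 2 * s - a)) \<partial>lborel \<partial>lborel)"
    by (rule lborel_pair.Fubini'[symmetric]) measurable
  also have "\<dots> = (\<integral>\<^sup>+a. \<integral>\<^sup>+b. ?n a * ?n b * H a b \<partial>lborel \<partial>lborel)"
  proof (rule nn_integral_cong)
    fix a :: real
    have e: "sqrt 2 * (a / sqrt 2 + 1 / sqrt 2 * b) - a = b" "a / sqrt 2 + 1 / sqrt 2 * b = (a + b) / sqrt 2"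
      "sqrt 2 * a - (a + b) / sqrt 2 = (a - b) / sqrt 2" for b
      by (simp_all add: field_simps)
    have "(\<integral>\<^sup>+s. ennreal (sqrt 2) * (?n s * ?n (sqrt 2 * a - s) * H a (sqrt 2 * s - a)) \<partial>lborel)
        = ennreal \<bar>1 / sqrt 2\<bar> * (\<integral>\<^sup>+b. ennreal (sqrt 2) * (?n ((a + b) / sqrt 2) * ?n ((a - b) / sqrt 2) * H a b) \<partial>lborel)"
      by (subst nn_integral_real_affine[where c = "1 / sqrt 2" and t = "a / sqrt 2"]) (simp_all only: e, simp_all)
    also have "\<dots> = (ennreal (1 / sqrt 2) * ennreal (sqrt 2)) * (\<integral>\<^sup>+b. ?n a * ?n b * H a b \<partial>lborel)"
      by (simp add: rot nn_integral_cmult mult.assoc)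
    also have "ennreal (1 / sqrt 2) * ennreal (sqrt 2) = 1"
      by (simp flip: ennreal_mult)
    finally show "(\<integral>\<^sup>+s. ennreal (sqrt 2) * (?n s * ?n (sqrt 2 * a - s) * H a (sqrt 2 * s - a)) \<partial>lborel)
        = (\<integral>\<^sup>+b. ?n a * ?n b * H a b \<partial>lborel)" by simp
  qed
  also have "\<dots> = (\<integral>\<^sup>+s. \<integral>\<^sup>+r. H s r \<partial>std_normal_distribution \<partial>std_normal_distribution)"
    by (rule dens[symmetric]) measurable
  finally show ?thesis .
qed

lemma nn_integral_gaussian_rotate:
  fixes F :: "(nat \<Rightarrow> real) \<Rightarrow> (nat \<Rightarrow> real) \<Rightarrow> ennreal"
  assumes "case_prod F \<in> borel_measurable (borel \<Otimes>\<^sub>M borel)"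
  shows "(\<integral>\<^sup>+x. \<integral>\<^sup>+y. F ((1 / sqrt 2) *\<^sub>R (x + y)) ((1 / sqrt 2) *\<^sub>R (x - y)) \<partial>gaussian_measure n \<partial>gaussian_measure n)
    = (\<integral>\<^sup>+x. \<integral>\<^sup>+y. F x y \<partial>gaussian_measure n \<partial>gaussian_measure n)"
  using assms
proof (induction n arbitrary: F)
  case 0
  interpret prob_space "gaussian_measure 0" by (rule prob_space_gaussian_measure)
  note [measurable] = 0
  have [measurable]: "(\<lambda>p :: (nat \<Rightarrow> real) \<times> (nat \<Rightarrow> real). fst p i) \<in> borel_measurable (borel \<Otimes>\<^sub>M borel)"
      "(\<lambda>p :: (nat \<Rightarrow> real) \<times> (nat \<Rightarrow> real). snd p i) \<in> borel_measurable (borel \<Otimes>\<^sub>M borel)" for i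
    by (auto intro: measurable_compose[OF measurable_fst measurable_product_coordinates]
        measurable_compose[OF measurable_snd measurable_product_coordinates])
  have [measurable]: "(\<lambda>p. (1 / sqrt 2) *\<^sub>R (fst p + snd p)) \<in> borel \<Otimes>\<^sub>M borel \<rightarrow>\<^sub>M (borel :: (nat \<Rightarrow> real) measure)"
      "(\<lambda>p. (1 / sqrt 2) *\<^sub>R (fst p - snd p)) \<in> borel \<Otimes>\<^sub>M borel \<rightarrow>\<^sub>M (borel :: (nat \<Rightarrow> real) measure)"
    by (rule measurable_coordinatewise_then_product; simp)+
  have m: "(\<lambda>(x, y). F ((1 / sqrt 2) *\<^sub>R (x + y)) ((1 / sqrt 2) *\<^sub>R (x - y))) \<in> borel_measurable (borel \<Otimes>\<^sub>M borel)"
    unfolding case_prod_beta by measurable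
  have eval: "(\<integral>\<^sup>+x. \<integral>\<^sup>+y. G x y \<partial>gaussian_measure 0 \<partial>gaussian_measure 0) = G 0 0"
    if [measurable]: "case_prod G \<in> borel_measurable (borel \<Otimes>\<^sub>M borel)" for G :: "(nat \<Rightarrow> real) \<Rightarrow> (nat \<Rightarrow> real) \<Rightarrow> ennreal"
  proof -
    have "(\<integral>\<^sup>+x. \<integral>\<^sup>+y. G x y \<partial>gaussian_measure 0 \<partial>gaussian_measure 0) = (\<integral>\<^sup>+y. G 0 y \<partial>gaussian_measure 0)"
      by (rule nn_integral_gaussian_0) measurable
    also have "\<dots> = G 0 0" by (rule nn_integral_gaussian_0) measurable
    finally show ?thesis .
  qed
  show ?case by (simp only: eval[OF m] eval[OF 0] scaleR_zero_right add_0_left diff_self)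
next
  case (Suc n)
  interpret \<gamma>: prob_space "gaussian_measure n" by (rule prob_space_gaussian_measure)
  interpret \<gamma>': prob_space "gaussian_measure (Suc n)" by (rule prob_space_gaussian_measure)
  interpret N: prob_space std_normal_distribution by (rule prob_space_normal_density) simp
  interpret P: pair_sigma_finite "gaussian_measure n" std_normal_distribution ..
  note [measurable] = Suc.prems
  have coord [measurable]: "(\<lambda>x :: nat \<Rightarrow> real. x i) \<in> borel_measurable borel" for i
    by (rule measurable_product_coordinates)
  have upd [measurable (raw)]: "(\<lambda>w. (f w)(n := g w)) \<in> M \<rightarrow>\<^sub>M (borel :: (nat \<Rightarrow> real) measure)"
    if [measurable]: "f \<in> M \<rightarrow>\<^sub>M borel" "g \<in> M \<rightarrow>\<^sub>M borel" for f g M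
    using measurable_compose[OF measurable_Pair[OF that] measurable_fun_upd_borel[of n]] by simp
  have lin [measurable (raw)]: "(\<lambda>w. (1 / sqrt 2) *\<^sub>R (f w + g w)) \<in> M \<rightarrow>\<^sub>M (borel :: (nat \<Rightarrow> real) measure)"
      "(\<lambda>w. (1 / sqrt 2) *\<^sub>R (f w - g w)) \<in> M \<rightarrow>\<^sub>M (borel :: (nat \<Rightarrow> real) measure)"
    if "f \<in> M \<rightarrow>\<^sub>M borel" "g \<in> M \<rightarrow>\<^sub>M borel" for f g M
    using measurable_compose[OF that(1) coord] measurable_compose[OF that(2) coord]
    by (intro measurable_coordinatewise_then_product; simp)+
  \<comment> \<open>The last coordinates of both points become the innermost pair of integrals,
    where the planar rotation acts on them.\<close>
  have split: "(\<integral>\<^sup>+x. \<integral>\<^sup>+y. G x y \<partial>gaussian_measure (Suc n) \<partial>gaussian_measure (Suc n))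
      = (\<integral>\<^sup>+x. \<integral>\<^sup>+y. \<integral>\<^sup>+s. \<integral>\<^sup>+r. G (x(n := s)) (y(n := r)) \<partial>std_normal_distribution \<partial>std_normal_distribution \<partial>gaussian_measure n \<partial>gaussian_measure n)"
    if [measurable]: "case_prod G \<in> borel_measurable (borel \<Otimes>\<^sub>M borel)" for G :: "(nat \<Rightarrow> real) \<Rightarrow> (nat \<Rightarrow> real) \<Rightarrow> ennreal"
  proof -
    have "(\<integral>\<^sup>+x. \<integral>\<^sup>+y. G x y \<partial>gaussian_measure (Suc n) \<partial>gaussian_measure (Suc n))
        = (\<integral>\<^sup>+x. \<integral>\<^sup>+s. (\<integral>\<^sup>+y. G (x(n := s)) y \<partial>gaussian_measure (Suc n)) \<partial>std_normal_distribution \<partial>gaussian_measure n)"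
      by (rule nn_integral_gaussian_Suc) measurable
    also have "\<dots> = (\<integral>\<^sup>+x. \<integral>\<^sup>+s. (\<integral>\<^sup>+y. \<integral>\<^sup>+r. G (x(n := s)) (y(n := r)) \<partial>std_normal_distribution \<partial>gaussian_measure n) \<partial>std_normal_distribution \<partial>gaussian_measure n)"
      by (subst nn_integral_gaussian_Suc) measurable
    also have "\<dots> = (\<integral>\<^sup>+x. \<integral>\<^sup>+y. \<integral>\<^sup>+s. \<integral>\<^sup>+r. G (x(n := s)) (y(n := r)) \<partial>std_normal_distribution \<partial>std_normal_distribution \<partial>gaussian_measure n \<partial>gaussian_measure n)"
      by (intro nn_integral_cong P.Fubini') measurable
    finally show ?thesis .
  qed
  define H where "H x y = (\<integral>\<^sup>+s. \<integral>\<^sup>+r. F (x(n := s)) (y(n := r)) \<partial>std_normal_distribution \<partial>std_normal_distribution)" for x y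
  have [measurable]: "case_prod H \<in> borel_measurable (borel \<Otimes>\<^sub>M borel)"
    unfolding H_def case_prod_beta by measurable
  have "(\<integral>\<^sup>+x. \<integral>\<^sup>+y. F ((1 / sqrt 2) *\<^sub>R (x + y)) ((1 / sqrt 2) *\<^sub>R (x - y)) \<partial>gaussian_measure (Suc n) \<partial>gaussian_measure (Suc n))
      = (\<integral>\<^sup>+x. \<integral>\<^sup>+y. \<integral>\<^sup>+s. \<integral>\<^sup>+r. F ((1 / sqrt 2) *\<^sub>R (x(n := s) + y(n := r))) ((1 / sqrt 2) *\<^sub>R (x(n := s) - y(n := r)))
          \<partial>std_normal_distribution \<partial>std_normal_distribution \<partial>gaussian_measure n \<partial>gaussian_measure n)"
    by (rule split) (unfold case_prod_beta, measurable)
  also have "\<dots> = (\<integral>\<^sup>+x. \<integral>\<^sup>+y. H ((1 / sqrt 2) *\<^sub>R (x + y)) ((1 / sqrt 2) *\<^sub>R (x - y)) \<partial>gaussian_measure n \<partial>gaussian_measure n)"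
  proof (intro nn_integral_cong)
    fix x y :: "nat \<Rightarrow> real"
    have e: "(1 / sqrt 2) *\<^sub>R (x(n := s) + y(n := r)) = ((1 / sqrt 2) *\<^sub>R (x + y))(n := (s + r) / sqrt 2)"
      "(1 / sqrt 2) *\<^sub>R (x(n := s) - y(n := r)) = ((1 / sqrt 2) *\<^sub>R (x - y))(n := (s - r) / sqrt 2)" for s r
      by (auto simp: fun_eq_iff)
    show "(\<integral>\<^sup>+s. \<integral>\<^sup>+r. F ((1 / sqrt 2) *\<^sub>R (x(n := s) + y(n := r))) ((1 / sqrt 2) *\<^sub>R (x(n := s) - y(n := r))) \<partial>std_normal_distribution \<partial>std_normal_distribution)
        = H ((1 / sqrt 2) *\<^sub>R (x + y)) ((1 / sqrt 2) *\<^sub>R (x - y))"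
      unfolding e H_def
      by (rule nn_integral_std_normal_rotate) (unfold case_prod_beta, measurable)
  qed
  also have "\<dots> = (\<integral>\<^sup>+x. \<integral>\<^sup>+y. H x y \<partial>gaussian_measure n \<partial>gaussian_measure n)"
    by (rule Suc.IH) measurable
  also have "\<dots> = (\<integral>\<^sup>+x. \<integral>\<^sup>+y. F x y \<partial>gaussian_measure (Suc n) \<partial>gaussian_measure (Suc n))"
    unfolding H_def by (rule split[symmetric]) measurable
  finally show ?case .
qed

section \<open>Gaussian tails and mean excess of a seminorm\<close>

definition is_seminorm :: "((nat \<Rightarrow> real) \<Rightarrow> real) \<Rightarrow> bool" where
  "is_seminorm N \<longleftrightarrow> (\<forall>x y. N (x + y) \<le> N x + N y) \<and> (\<forall>c x. N (c *\<^sub>R x) = \<bar>c\<bar> * N x)"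

text \<open>Fernique's argument. Both orders of the pair (small, large) are counted; the factor 2 gained
  in this way is what makes the bound useful already at the threshold \<open>1 / 2\<close>.\<close>

lemma gaussian_seminorm_tail_square:
  assumes N: "is_seminorm N" and [measurable]: "N \<in> borel_measurable borel" and t: "0 \<le> t"
    and half: "measure (gaussian_measure n) {x. t < N x} \<le> 1 / 2"
  shows "measure (gaussian_measure n) {x. 3 * t < N x} \<le> (measure (gaussian_measure n) {x. t < N x})\<^sup>2"
proof -
  let ?G = "gaussian_measure n"
  interpret prob_space ?G by (rule prob_space_gaussian_measure)
  have sp: "space ?G = UNIV" by (simp add: gaussian_measure_def)
  define A where "A = {x. N x \<le> t}"
  define B where "B = {x. 3 * t < N x}"
  define C where "C = {x. t < N x}"
  have [measurable]: "A \<in> sets borel" "B \<in> sets borel" "C \<in> sets borel"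
    unfolding A_def B_def C_def by measurable
  have tri: "N (x + y) \<le> N x + N y" and hom: "N (c *\<^sub>R x) = \<bar>c\<bar> * N x" for x y c
    using N by (auto simp: is_seminorm_def)
  have neg: "N (- x) = N x" for x using hom[of "-1" x] by simp
  have big: "t < N ((1 / sqrt 2) *\<^sub>R (x + y)) \<and> t < N ((1 / sqrt 2) *\<^sub>R (x - y))"
    if "(N x \<le> t \<and> 3 * t < N y) \<or> (3 * t < N x \<and> N y \<le> t)" for x y
  proof -
    have "N y \<le> N (x + y) + N x" "N x \<le> N (x + y) + N y" "N y \<le> N (x - y) + N x" "N x \<le> N (x - y) + N y"
      using tri[of "x + y" "- x"] tri[of "x + y" "- y"] tri[of "x - y" "- x"] tri[of "x - y" y] neg[of x] neg[of y]
        neg[of "x - y"] tri[of "- (x - y)" x]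
      by auto
    then have "2 * t < N (x + y)" "2 * t < N (x - y)" using that by auto
    moreover have "sqrt 2 * t \<le> 2 * t" using t sqrt2_less_2 by (intro mult_right_mono) auto
    ultimately show ?thesis by (simp only: hom) (simp add: field_simps)
  qed
  have AC: "A = - C" by (auto simp: A_def C_def)
  \<comment> \<open>As \<open>0 \<le> t\<close>, the sets \<open>A\<close> and \<open>B\<close> are
    disjoint, so at most one of the two products is 1 and their sum is still bounded by an
    indicator.\<close>
  have disj: "indicator A x * indicator B y + indicator B x * indicator A y
      \<le> (indicator C ((1 / sqrt 2) *\<^sub>R (x + y)) * indicator C ((1 / sqrt 2) *\<^sub>R (x - y)) :: ennreal)" for x y
    using big[of x y] t by (auto simp: indicator_def A_def B_def C_def)
  have prod: "(\<integral>\<^sup>+x. \<integral>\<^sup>+y. indicator S x * indicator R y \<partial>?G \<partial>?G) = emeasure ?G S * emeasure ?G R"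
    if [measurable]: "S \<in> sets borel" "R \<in> sets borel" for S R
    by (simp add: nn_integral_cmult nn_integral_multc)
  have "2 * (emeasure ?G A * emeasure ?G B)
      = (\<integral>\<^sup>+x. \<integral>\<^sup>+y. indicator A x * indicator B y + indicator B x * indicator A y \<partial>?G \<partial>?G)"
    by (simp add: nn_integral_add nn_integral_cmult nn_integral_multc mult_2 mult.commute)
  also have "\<dots> \<le> (\<integral>\<^sup>+x. \<integral>\<^sup>+y. indicator C ((1 / sqrt 2) *\<^sub>R (x + y)) * indicator C ((1 / sqrt 2) *\<^sub>R (x - y)) \<partial>?G \<partial>?G)"
    by (intro nn_integral_mono disj)
  also have "\<dots> = (\<integral>\<^sup>+x. \<integral>\<^sup>+y. indicator C x * indicator C y \<partial>?G \<partial>?G)"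
    by (rule nn_integral_gaussian_rotate) measurable
  also have "\<dots> = emeasure ?G C * emeasure ?G C" by (rule prod) measurable
  finally have "2 * (emeasure ?G A * emeasure ?G B) \<le> emeasure ?G C * emeasure ?G C" .
  then have "ennreal (2 * (measure ?G A * measure ?G B)) \<le> ennreal (measure ?G C * measure ?G C)"
    by (simp add: emeasure_eq_measure ennreal_mult)
  then have "2 * (measure ?G A * measure ?G B) \<le> measure ?G C * measure ?G C"
    by (subst (asm) ennreal_le_iff) auto
  moreover have "measure ?G A = 1 - measure ?G C"
    using prob_compl[of C] by (simp add: AC sp Compl_eq_Diff_UNIV)
  then have "1 / 2 * measure ?G B \<le> measure ?G A * measure ?G B"
    using half by (intro mult_right_mono) (auto simp: C_def)
  ultimately show ?thesis by (simp add: B_def C_def power2_eq_square)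
qed

text \<open>Each squaring triples the level. The bound never rises above \<open>1 / 2\<close>, so
  the squaring step can be repeated.\<close>

lemma gaussian_seminorm_tail:
  assumes N: "is_seminorm N" and m: "N \<in> borel_measurable borel"
    and \<eta>: "measure (gaussian_measure n) {x. 1 < N x} \<le> \<eta>" "\<eta> \<le> 1 / 2"
  shows "measure (gaussian_measure n) {x. 3 ^ k < N x} \<le> \<eta> ^ (2 ^ k)"
proof (induction k)
  case (Suc k)
  have \<eta>0: "0 \<le> \<eta>" using \<eta>(1) measure_nonneg order_trans by blast
  have "\<eta> ^ (2 ^ k) \<le> \<eta> ^ 1" using \<eta>0 \<eta>(2) by (intro power_decreasing) auto
  then have "measure (gaussian_measure n) {x. 3 ^ k < N x} \<le> 1 / 2" using Suc \<eta>(2) by simp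
  then have "measure (gaussian_measure n) {x. 3 * 3 ^ k < N x} \<le> (measure (gaussian_measure n) {x. 3 ^ k < N x})\<^sup>2"
    by (intro gaussian_seminorm_tail_square[OF N m]) auto
  also have "\<dots> \<le> (\<eta> ^ (2 ^ k))\<^sup>2" using Suc by (intro power_mono) auto
  also have "\<dots> = \<eta> ^ (2 ^ Suc k)" by (simp add: power_mult[symmetric] mult.commute)
  finally show ?case by simp
qed (use \<eta> in simp)

text \<open>If \<open>j\<close> is least with \<open>N x \<le> 3 ^ j\<close>, the excess is at most
  \<open>3 ^ j - 1\<close>, the sum of \<open>2 * 3 ^ k\<close> over \<open>k < j\<close>. In the
  tail bound \<open>\<eta> ^ (2 ^ k)\<close> one factor \<open>\<eta>\<close> is kept and the others
  are replaced by \<open>1 / 2\<close>; with \<open>2 * k \<le> 2 ^ k\<close> this leaves a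
  geometric series of ratio \<open>3 / 4\<close> and sum \<open>16 * \<eta>\<close>.\<close>

lemma nn_integral_gaussian_seminorm_excess:
  assumes N: "is_seminorm N" and m [measurable]: "N \<in> borel_measurable borel"
    and \<eta>: "measure (gaussian_measure n) {x. 1 < N x} \<le> \<eta>" "\<eta> \<le> 1 / 2"
  shows "(\<integral>\<^sup>+x. max 0 (N x - 1) \<partial>gaussian_measure n) \<le> ennreal (16 * \<eta>)"
proof -
  let ?G = "gaussian_measure n"
  interpret prob_space ?G by (rule prob_space_gaussian_measure)
  have \<eta>0: "0 \<le> \<eta>" using \<eta>(1) measure_nonneg order_trans by blast
  have [measurable]: "{x. 3 ^ k < N x} \<in> sets borel" for k by measurable
  have "ennreal (max 0 (N x - 1)) \<le> (\<Sum>k. ennreal (2 * 3 ^ k) * indicator {x. 3 ^ k < N x} x)" for x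
  proof (cases "1 < N x")
    case True
    define j where "j = (LEAST j. N x \<le> 3 ^ j)"
    obtain i where "N x \<le> 3 ^ i" using real_arch_pow[of 3 "N x"] less_imp_le by auto
    then have j: "N x \<le> 3 ^ j" unfolding j_def by (rule LeastI[of "\<lambda>j. N x \<le> 3 ^ j"])
    have lt: "3 ^ k < N x" if "k < j" for k
      using not_less_Least[of k "\<lambda>j. N x \<le> 3 ^ j"] that by (simp add: j_def)
    have geo: "(\<Sum>k<j. 2 * 3 ^ k) = (3 ^ j - 1 :: real)" by (induction j) auto
    have "ennreal (max 0 (N x - 1)) \<le> ennreal (\<Sum>k<j. 2 * 3 ^ k)"
      unfolding geo using True j by (intro ennreal_leI) auto
    also have "\<dots> = (\<Sum>k<j. ennreal (2 * 3 ^ k) * indicator {x. 3 ^ k < N x} x)"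
      using lt by (subst sum_ennreal[symmetric]) (auto intro!: sum.cong)
    also have "\<dots> \<le> (\<Sum>k. ennreal (2 * 3 ^ k) * indicator {x. 3 ^ k < N x} x)"
      by (rule sum_le_suminf) auto
    finally show ?thesis .
  qed simp
  then have "(\<integral>\<^sup>+x. max 0 (N x - 1) \<partial>?G) \<le> (\<integral>\<^sup>+x. (\<Sum>k. ennreal (2 * 3 ^ k) * indicator {x. 3 ^ k < N x} x) \<partial>?G)"
    by (intro nn_integral_mono)
  also have "\<dots> = (\<Sum>k. ennreal (2 * 3 ^ k) * emeasure ?G {x. 3 ^ k < N x})"
    by (simp add: nn_integral_suminf nn_integral_cmult)
  also have "\<dots> \<le> (\<Sum>k. ennreal (4 * \<eta> * (3 / 4) ^ k))"
  proof (intro suminf_le summableI)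
    fix k :: nat
    have "2 * k \<le> 2 ^ k"
    proof (induction k rule: less_induct)
      case (less k)
      show ?case
      proof (cases "k \<le> 2")
        case True
        then have "k = 0 \<or> k = 1 \<or> k = 2" by linarith
        then show ?thesis by auto
      next
        case False
        then obtain j where "k = Suc j" "2 \<le> j" by (cases k) auto
        then show ?thesis using less[of j] by simp
      qed
    qed
    then have "(1 / 2 :: real) ^ (2 ^ k) \<le> (1 / 2) ^ (2 * k)" by (intro power_decreasing) auto
    then have half: "(1 / 2 :: real) ^ (2 ^ k) \<le> (1 / 4) ^ k" by (simp add: power_mult power2_eq_square)
    have "\<eta> ^ (2 ^ k) = \<eta> * \<eta> ^ (2 ^ k - 1)" by (simp flip: power_Suc)
    also have "\<dots> \<le> \<eta> * (1 / 2) ^ (2 ^ k - 1)" using \<eta> \<eta>0 by (intro mult_left_mono power_mono)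
    also have "\<dots> = 2 * \<eta> * (1 / 2) ^ (2 ^ k)"
      using power_Suc[of "1 / 2 :: real" "2 ^ k - 1"] by simp
    also have "\<dots> \<le> 2 * \<eta> * (1 / 4) ^ k" using half \<eta>0 by (intro mult_left_mono) auto
    finally have "measure ?G {x. 3 ^ k < N x} \<le> 2 * \<eta> * (1 / 4) ^ k"
      using gaussian_seminorm_tail[OF N m \<eta>, of k] by simp
    then have "2 * 3 ^ k * measure ?G {x. 3 ^ k < N x} \<le> 2 * 3 ^ k * (2 * \<eta> * (1 / 4) ^ k)"
      by (intro mult_left_mono) auto
    also have "\<dots> = 4 * \<eta> * (3 / 4) ^ k" by (simp add: power_divide)
    finally have "ennreal (2 * 3 ^ k * measure ?G {x. 3 ^ k < N x}) \<le> ennreal (4 * \<eta> * (3 / 4) ^ k)"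
      by (rule ennreal_leI)
    then show "ennreal (2 * 3 ^ k) * emeasure ?G {x. 3 ^ k < N x} \<le> ennreal (4 * \<eta> * (3 / 4) ^ k)"
      unfolding emeasure_eq_measure by (subst ennreal_mult[symmetric]) auto
  qed
  also have "\<dots> = ennreal (16 * \<eta>)"
  proof -
    have "(\<lambda>k. 4 * \<eta> * (3 / 4) ^ k) sums (4 * \<eta> * (1 / (1 - 3 / 4)))"
      by (intro sums_mult geometric_sums) auto
    then show ?thesis using \<eta>0 by (intro suminf_ennreal_eq) auto
  qed
  finally show ?thesis .
qed

section \<open>Randomised strategies\<close>

definition short_vector :: "nat \<Rightarrow> (nat \<Rightarrow> real) \<Rightarrow> bool" where
  "short_vector n v \<longleftrightarrow> (\<forall>i\<ge>n. v i = 0) \<and> (\<Sum>i<n. (v i)\<^sup>2) \<le> 1 / 64"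

definition weighted_sum :: "real list \<Rightarrow> (nat \<Rightarrow> real) list \<Rightarrow> nat \<Rightarrow> real" where
  "weighted_sum xs ws = (\<Sum>(x, w)\<leftarrow>zip xs ws. x *\<^sub>R w)"

definition sign_lists :: "nat \<Rightarrow> real list set" where
  "sign_lists k = {xs. set xs \<subseteq> {-1, 1} \<and> length xs = k}"

text \<open>A deterministic strategy needs only the vectors seen so far, because they determine its
  own earlier signs. As it is evaluated on prefixes, it is online by construction.\<close>

definition response :: "('a list \<Rightarrow> real) \<Rightarrow> 'a list \<Rightarrow> real list" where
  "response \<sigma> ws = map (\<lambda>i. \<sigma> (take (Suc i) ws)) [0..<length ws]"

lemma finite_sign_lists [simp]: "finite (sign_lists k)"
  unfolding sign_lists_def by (rule finite_lists_length_eq) simp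

lemma weighted_sum_simps [simp]:
  "weighted_sum [] ws = 0" "weighted_sum xs [] = 0"
  "weighted_sum (x # xs) (w # ws) = x *\<^sub>R w + weighted_sum xs ws"
  by (simp_all add: weighted_sum_def)

lemma response_Nil [simp]: "response \<sigma> [] = []"
  by (simp add: response_def)

lemma response_Cons: "response \<sigma> (w # ws) = \<sigma> [w] # response (\<lambda>u. \<sigma> (w # u)) ws"
  by (simp add: response_def upt_conv_Cons map_Suc_upt[symmetric] del: upt_Suc map_Suc_upt)

lemma response_snoc: "response \<sigma> (ws @ [w]) = response \<sigma> ws @ [\<sigma> (ws @ [w])]"
  by (simp add: response_def)

lemma response_cong:
  assumes "\<And>u. u \<noteq> [] \<Longrightarrow> \<sigma> u = \<tau> u"
  shows "response \<sigma> ws = response \<tau> ws"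
  unfolding response_def by (intro map_cong refl assms) auto

lemma response_in_sign_lists: "range \<sigma> \<subseteq> {-1, 1} \<Longrightarrow> response \<sigma> ws \<in> sign_lists (length ws)"
  by (force simp: response_def sign_lists_def)

section \<open>Backward induction over finitely many weighted sequences\<close>

lemma sum_lists_by_hd:
  fixes g :: "'a list \<Rightarrow> 'b :: comm_monoid_add"
  assumes "finite W"
  shows "sum g W = (if [] \<in> W then g [] else 0) + (\<Sum>v\<in>hd ` (W - {[]}). \<Sum>ws\<in>{ws. v # ws \<in> W}. g (v # ws))"
proof -
  have fin: "finite {ws. v # ws \<in> W}" for v
    using finite_vimageI[OF assms, of "(#) v"] by (simp add: vimage_def)
  have "W - {[]} = (\<lambda>(v, ws). v # ws) ` (SIGMA v:hd ` (W - {[]}). {ws. v # ws \<in> W})"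
  proof (intro equalityI subsetI)
    fix w assume w: "w \<in> W - {[]}"
    then show "w \<in> (\<lambda>(v, ws). v # ws) ` (SIGMA v:hd ` (W - {[]}). {ws. v # ws \<in> W})"
      by (intro image_eqI[of _ _ "(hd w, tl w)"]) auto
  qed auto
  then have "sum g (W - {[]}) = sum g ((\<lambda>(v, ws). v # ws) ` (SIGMA v:hd ` (W - {[]}). {ws. v # ws \<in> W}))"
    by (rule arg_cong)
  also have "\<dots> = (\<Sum>(v, ws)\<in>(SIGMA v:hd ` (W - {[]}). {ws. v # ws \<in> W}). g (v # ws))"
    by (subst sum.reindex) (auto simp: inj_on_def case_prod_beta)
  also have "\<dots> = (\<Sum>v\<in>hd ` (W - {[]}). \<Sum>ws\<in>{ws. v # ws \<in> W}. g (v # ws))"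
    using assms fin by (subst sum.Sigma) auto
  finally show ?thesis
    using assms by (cases "[] \<in> W") (simp_all add: sum.remove)
qed

text \<open>\<open>f y\<close> bounds the cost still to come from position \<open>y\<close>; a sign
  moves the position, so all \<open>y\<close> are treated together. Cost is charged only at the end
  of each sequence, and earlier times are covered by having prefixes in \<open>W\<close>. The next
  vector is known before its sign is chosen, so every branch brings its own recentred value
  function, and the bounds on the Gaussian means add up along the tree.\<close>

lemma strategy_value_function:
  assumes \<phi>: "cost_fun n \<phi>" and B: "(\<integral>\<^sup>+x. \<phi> x \<partial>gaussian_measure n) \<le> ennreal B" "0 \<le> B"
    and W: "finite W" "\<And>w. w \<in> W \<Longrightarrow> length w < h" "\<And>w. w \<in> W \<Longrightarrow> \<forall>v\<in>set w. short_vector n v"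
    and p: "\<And>w. 0 \<le> p w"
  shows "\<exists>f. cost_fun n f \<and> (\<integral>\<^sup>+x. f x \<partial>gaussian_measure n) \<le> ennreal (B * sum p W) \<and>
    (\<forall>y. \<exists>\<sigma>. range \<sigma> \<subseteq> {-1, 1} \<and> (\<Sum>w\<in>W. p w * \<phi> (y + weighted_sum (response \<sigma> w) w)) \<le> f y)"
  using W p
proof (induction h arbitrary: W p)
  case 0
  then have "W = {}" by auto
  then show ?case
    by (intro exI[of _ "\<lambda>_. 0"]) (auto simp: cost_fun_zero intro!: exI[of _ "\<lambda>_. 1"])
next
  case (Suc h)
  define V where "V = hd ` (W - {[]})"
  define Wv where "Wv v = {ws. v # ws \<in> W}" for v
  define r where "r = (if [] \<in> W then p [] else 0)"
  have V: "short_vector n v" if "v \<in> V" for v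
    using Suc.prems(3) that by (force simp: V_def intro: hd_in_set)
  have finV: "finite V" using Suc.prems(1) by (simp add: V_def)
  note split = sum_lists_by_hd[OF Suc.prems(1), folded V_def Wv_def]
  define good where "good v y \<sigma> b \<longleftrightarrow> range \<sigma> \<subseteq> {-1, 1} \<and>
    (\<Sum>ws\<in>Wv v. p (v # ws) * \<phi> (y + weighted_sum (response \<sigma> ws) ws)) \<le> b" for v y \<sigma> b
  have "\<exists>f. cost_fun n f \<and> (\<integral>\<^sup>+x. f x \<partial>gaussian_measure n) \<le> ennreal (B * (\<Sum>ws\<in>Wv v. p (v # ws))) \<and>
    (\<forall>y. \<exists>\<sigma>. good v y \<sigma> (f y))" for v
    unfolding good_def
  proof (rule Suc.IH)
    show "finite (Wv v)"
      using finite_vimageI[OF Suc.prems(1), of "(#) v"] by (simp add: vimage_def Wv_def)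
    show "length w < h" "\<forall>v\<in>set w. short_vector n v" if "w \<in> Wv v" for w
      using Suc.prems(2,3)[of "v # w"] that by (simp_all add: Wv_def)
  qed (rule Suc.prems(4))
  then obtain f where f: "\<And>v. cost_fun n (f v)"
      "\<And>v. (\<integral>\<^sup>+x. f v x \<partial>gaussian_measure n) \<le> ennreal (B * (\<Sum>ws\<in>Wv v. p (v # ws)))"
    and strat: "\<And>v y. \<exists>\<sigma>. good v y \<sigma> (f v y)"
    by metis
  define F where "F y = r * \<phi> y + (\<Sum>v\<in>V. recenter (f v) v y)" for y
  note [measurable] = cost_fun_measurable[OF \<phi>] cost_fun_measurable[OF cost_fun_recenter[OF f(1)]]
  have r0: "0 \<le> r" using Suc.prems(4) by (simp add: r_def)
  have "cost_fun n F"
    unfolding F_def by (intro cost_fun_add cost_fun_cmult cost_fun_sum \<phi> r0 finV cost_fun_recenter f)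
  moreover have "(\<integral>\<^sup>+x. F x \<partial>gaussian_measure n) \<le> ennreal (B * sum p W)"
  proof -
    have rec0: "0 \<le> recenter (f v) v x" for v x
      by (rule cost_fun_nonneg[OF cost_fun_recenter[OF f(1)]])
    have "(\<integral>\<^sup>+x. F x \<partial>gaussian_measure n)
        = (\<integral>\<^sup>+x. ennreal r * ennreal (\<phi> x) + (\<Sum>v\<in>V. ennreal (recenter (f v) v x)) \<partial>gaussian_measure n)"
      unfolding F_def using r0 rec0 cost_fun_nonneg[OF \<phi>]
      by (simp add: ennreal_plus ennreal_mult sum_nonneg sum_ennreal)
    also have "\<dots> = ennreal r * (\<integral>\<^sup>+x. \<phi> x \<partial>gaussian_measure n) + (\<Sum>v\<in>V. \<integral>\<^sup>+x. recenter (f v) v x \<partial>gaussian_measure n)"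
      by (subst nn_integral_add) (auto simp: nn_integral_cmult nn_integral_sum)
    also have "\<dots> \<le> ennreal r * ennreal B + (\<Sum>v\<in>V. ennreal (B * (\<Sum>ws\<in>Wv v. p (v # ws))))"
    proof (intro add_mono mult_left_mono sum_mono B(1))
      fix v assume "v \<in> V"
      then show "(\<integral>\<^sup>+x. recenter (f v) v x \<partial>gaussian_measure n) \<le> ennreal (B * (\<Sum>ws\<in>Wv v. p (v # ws)))"
        using nn_integral_recenter_le[OF f(1), of v v] V[of v] f(2)[of v]
        by (auto simp: short_vector_def intro: order_trans)
    qed simp
    also have "\<dots> = ennreal (r * B + (\<Sum>v\<in>V. B * (\<Sum>ws\<in>Wv v. p (v # ws))))"
      using r0 B(2) Suc.prems(4) by (subst sum_ennreal) (simp_all add: ennreal_plus ennreal_mult[of r] sum_nonneg)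
    also have "r * B + (\<Sum>v\<in>V. B * (\<Sum>ws\<in>Wv v. p (v # ws))) = B * sum p W"
      by (simp add: split r_def sum_distrib_left distrib_left mult.commute)
    finally show ?thesis .
  qed
  moreover have "\<exists>\<sigma>. range \<sigma> \<subseteq> {-1, 1} \<and> (\<Sum>w\<in>W. p w * \<phi> (y + weighted_sum (response \<sigma> w) w)) \<le> F y" for y
  proof -
    have "\<exists>s. (s = -1 \<or> s = 1) \<and> f v (y + s *\<^sub>R v) \<le> recenter (f v) v y" for v
      using recenter_ge_min[OF f(1), of v y v] by (cases "f v (y + v) \<le> f v (y - v)") (auto intro: exI[of _ 1] exI[of _ "-1"])
    then obtain s where s: "\<And>v. s v = -1 \<or> s v = 1" "\<And>v. f v (y + s v *\<^sub>R v) \<le> recenter (f v) v y"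
      by metis
    have "\<forall>v. \<exists>\<sigma>. good v (y + s v *\<^sub>R v) \<sigma> (f v (y + s v *\<^sub>R v))"
      by (rule allI) (rule strat)
    from choice[OF this] obtain \<tau> where "\<forall>v. good v (y + s v *\<^sub>R v) (\<tau> v) (f v (y + s v *\<^sub>R v))" ..
    then have \<tau>: "range (\<tau> v) \<subseteq> {-1, 1}"
      "(\<Sum>ws\<in>Wv v. p (v # ws) * \<phi> (y + s v *\<^sub>R v + weighted_sum (response (\<tau> v) ws) ws)) \<le> f v (y + s v *\<^sub>R v)" for v
      by (simp_all add: good_def)
    \<comment> \<open>The strategies of the subtrees are glued below the first sign
      \<open>s v\<close>; the value 1 at the empty list is a default that keeps the range within the
      signs.\<close>
    define \<sigma> where "\<sigma> u = (case u of [] \<Rightarrow> 1 | v # ws \<Rightarrow> if ws = [] then s v else \<tau> v ws)" for u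
    have \<sigma>: "range \<sigma> \<subseteq> {-1, 1}"
      using s(1) \<tau>(1) by (fastforce simp: \<sigma>_def split: list.splits)
    have resp: "response \<sigma> (v # ws) = s v # response (\<tau> v) ws" for v ws
    proof -
      have "response (\<lambda>u. \<sigma> (v # u)) ws = response (\<tau> v) ws"
        by (rule response_cong) (simp add: \<sigma>_def)
      then show ?thesis by (simp add: response_Cons) (simp add: \<sigma>_def)
    qed
    have "(\<Sum>w\<in>W. p w * \<phi> (y + weighted_sum (response \<sigma> w) w))
        = r * \<phi> y + (\<Sum>v\<in>V. \<Sum>ws\<in>Wv v. p (v # ws) * \<phi> (y + s v *\<^sub>R v + weighted_sum (response (\<tau> v) ws) ws))"
      by (simp add: split r_def resp add.assoc)
    also have "\<dots> \<le> F y"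
      unfolding F_def by (intro add_left_mono sum_mono order_trans[OF \<tau>(2) s(2)])
    finally show ?thesis using \<sigma> by blast
  qed
  ultimately show ?case by blast
qed

lemma exists_good_strategy:
  assumes \<phi>: "cost_fun n \<phi>" and B: "(\<integral>\<^sup>+x. \<phi> x \<partial>gaussian_measure n) \<le> ennreal B" "0 \<le> B"
    and W: "finite W" "\<And>w. w \<in> W \<Longrightarrow> \<forall>v\<in>set w. short_vector n v" and p: "\<And>w. 0 \<le> p w"
  obtains \<sigma> where "range \<sigma> \<subseteq> {-1, 1}" "(\<Sum>w\<in>W. p w * \<phi> (weighted_sum (response \<sigma> w) w)) \<le> B * sum p W"
proof -
  have len: "length w < Suc (Max (length ` W))" if "w \<in> W" for w
    using W(1) that by (simp add: le_imp_less_Suc)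
  obtain f where f: "cost_fun n f" "(\<integral>\<^sup>+x. f x \<partial>gaussian_measure n) \<le> ennreal (B * sum p W)"
    "\<And>y. \<exists>\<sigma>. range \<sigma> \<subseteq> {-1, 1} \<and> (\<Sum>w\<in>W. p w * \<phi> (y + weighted_sum (response \<sigma> w) w)) \<le> f y"
    using strategy_value_function[where p = p, OF \<phi> B W(1) len W(2) p] by blast
  obtain \<sigma> where \<sigma>: "range \<sigma> \<subseteq> {-1, 1}" "(\<Sum>w\<in>W. p w * \<phi> (0 + weighted_sum (response \<sigma> w) w)) \<le> f 0"
    using f(3)[of 0] by blast
  have "ennreal (f 0) \<le> ennreal (B * sum p W)"
    using cost_fun_0_le_nn_integral[OF f(1)] f(2) by (rule order_trans)
  then have "f 0 \<le> B * sum p W"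
    using B(2) p by (subst (asm) ennreal_le_iff) (auto intro!: mult_nonneg_nonneg sum_nonneg)
  then show thesis using that[of \<sigma>] \<sigma> by simp
qed

text \<open>The strategies are chosen greedily against the weights \<open>max 0 (\<dots>)\<close>, which keeps the sum of
  squared excesses linear in \<open>N\<close>; this replaces the minimax theorem.\<close>

lemma exists_strategy_mixture:
  assumes \<phi>: "cost_fun n \<phi>" and B: "(\<integral>\<^sup>+x. \<phi> x \<partial>gaussian_measure n) \<le> ennreal B" "0 \<le> B"
    and W: "finite W" "\<And>w. w \<in> W \<Longrightarrow> \<forall>v\<in>set w. short_vector n v" and \<epsilon>: "0 < \<epsilon>"
  obtains N s where "0 < (N :: nat)" "\<And>j. range (s j) \<subseteq> {-1, 1}"
    "\<And>w. w \<in> W \<Longrightarrow> (\<Sum>j<N. \<phi> (weighted_sum (response (s j) w) w)) \<le> N * (B + \<epsilon>)"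
proof -
  define a where "a \<sigma> w = \<phi> (weighted_sum (response \<sigma> w) w)" for \<sigma> w
  \<comment> \<open>A crude bound on every single cost: a sum of nonnegative terms over all sign
    patterns dominates each term.\<close>
  define M where "M = (\<Sum>w\<in>W. \<Sum>xs\<in>sign_lists (length w). \<phi> (weighted_sum xs w))"
  define E where "E s N w = max 0 ((\<Sum>j<N. a (s j) w) - real N * B)" for s and N :: nat and w
  define D where "D = card W * (M + B)\<^sup>2"
  note \<phi>0 = cost_fun_nonneg[OF \<phi>]
  have aM: "a \<sigma> w \<le> M" if "range \<sigma> \<subseteq> {-1, 1}" "w \<in> W" for \<sigma> w
  proof -
    have "a \<sigma> w \<le> (\<Sum>xs\<in>sign_lists (length w). \<phi> (weighted_sum xs w))"
      unfolding a_def using response_in_sign_lists[OF that(1)] by (intro member_le_sum) (auto simp: \<phi>0)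
    also have "\<dots> \<le> M"
      unfolding M_def using that(2) W(1)
      by (intro member_le_sum[of w W "\<lambda>w. \<Sum>xs\<in>sign_lists (length w). \<phi> (weighted_sum xs w)"]) (auto intro!: sum_nonneg simp: \<phi>0)
    finally show ?thesis .
  qed
  have M0: "0 \<le> M" unfolding M_def by (intro sum_nonneg \<phi>0)
  have pot: "\<exists>s. (\<forall>j. range (s j) \<subseteq> {-1, 1}) \<and> (\<Sum>w\<in>W. (E s N w)\<^sup>2) \<le> real N * D" for N
  proof (induction N)
    case 0
    show ?case by (intro exI[of _ "\<lambda>_ _. 1"]) (simp add: E_def)
  next
    case (Suc N)
    then obtain s where s: "\<And>j. range (s j) \<subseteq> {-1, 1}" "(\<Sum>w\<in>W. (E s N w)\<^sup>2) \<le> real N * D"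
      by blast
    have E0: "0 \<le> E s N w" for w by (simp add: E_def)
    \<comment> \<open>As in Blackwell's approachability theorem, weighting by the current excesses
      makes the cross term, the sum of \<open>E s N w * (a \<sigma> w - B)\<close>, nonpositive;
      each round then adds at most \<open>D\<close> to the sum of squares.\<close>
    obtain \<sigma> where \<sigma>: "range \<sigma> \<subseteq> {-1, 1}" "(\<Sum>w\<in>W. E s N w * a \<sigma> w) \<le> B * (\<Sum>w\<in>W. E s N w)"
      by (rule exists_good_strategy[where p = "E s N", OF \<phi> B W E0, folded a_def])
    have step: "(E (s(N := \<sigma>)) (Suc N) w)\<^sup>2 \<le> (E s N w)\<^sup>2 + 2 * (E s N w * a \<sigma> w - B * E s N w) + (M + B)\<^sup>2"
      if "w \<in> W" for w
    proof -
      define z where "z = (\<Sum>j<N. a (s j) w) - real N * B"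
      define b where "b = a \<sigma> w - B"
      have Ez: "E s N w = max 0 z" by (simp add: E_def z_def)
      have "\<bar>b\<bar> \<le> M + B" using aM[OF \<sigma>(1) that] M0 B(2) \<phi>0[of "weighted_sum (response \<sigma> w) w"]
        by (simp add: b_def a_def abs_le_iff)
      then have b2: "b\<^sup>2 \<le> (M + B)\<^sup>2" by (metis abs_ge_zero power2_abs power_mono)
      have "(max 0 (z + b))\<^sup>2 \<le> (max 0 z)\<^sup>2 + 2 * max 0 z * b + b\<^sup>2"
      proof (cases "0 \<le> z")
        case True
        have "(max 0 (z + b))\<^sup>2 \<le> (z + b)\<^sup>2" by (auto simp: max_def)
        then show ?thesis using True by (simp add: power2_sum)
      next
        case False
        then have "\<bar>max 0 (z + b)\<bar> \<le> \<bar>b\<bar>" by auto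
        then have "(max 0 (z + b))\<^sup>2 \<le> b\<^sup>2" by (simp only: abs_le_square_iff)
        then show ?thesis using False by simp
      qed
      moreover have "E (s(N := \<sigma>)) (Suc N) w = max 0 (z + b)"
        by (simp add: E_def z_def b_def algebra_simps)
      ultimately show ?thesis
        using b2 by (simp add: Ez b_def algebra_simps)
    qed
    have "(\<Sum>w\<in>W. (E (s(N := \<sigma>)) (Suc N) w)\<^sup>2)
        \<le> (\<Sum>w\<in>W. (E s N w)\<^sup>2 + 2 * (E s N w * a \<sigma> w - B * E s N w) + (M + B)\<^sup>2)"
      by (intro sum_mono step)
    also have "\<dots> = (\<Sum>w\<in>W. (E s N w)\<^sup>2) + 2 * ((\<Sum>w\<in>W. E s N w * a \<sigma> w) - B * (\<Sum>w\<in>W. E s N w)) + D"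
      by (simp add: sum.distrib sum_subtractf sum_distrib_left D_def)
    also have "\<dots> \<le> real (Suc N) * D" using s(2) \<sigma>(2) by (simp add: algebra_simps)
    finally have "(\<Sum>w\<in>W. (E (s(N := \<sigma>)) (Suc N) w)\<^sup>2) \<le> real (Suc N) * D" .
    moreover have "\<forall>j. range ((s(N := \<sigma>)) j) \<subseteq> {-1, 1}" using s(1) \<sigma>(1) by simp
    ultimately show ?case by blast
  qed
  \<comment> \<open>A squared excess is at most \<open>N * D\<close>, while the squared tolerance
    grows like \<open>N\<^sup>2 * \<epsilon>\<^sup>2\<close>; for this \<open>N\<close> the latter
    is larger.\<close>
  obtain N :: nat where N: "D / \<epsilon>\<^sup>2 < real N" using reals_Archimedean2 by blast
  have D0: "0 \<le> D" by (simp add: D_def)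
  then have "0 < N" using N \<epsilon> by (metis divide_nonneg_nonneg not_gr_zero of_nat_0 not_less zero_le_power2)
  obtain s where s: "\<And>j. range (s j) \<subseteq> {-1, 1}" "(\<Sum>w\<in>W. (E s N w)\<^sup>2) \<le> real N * D"
    using pot by blast
  have "(\<Sum>j<N. a (s j) w) \<le> N * (B + \<epsilon>)" if "w \<in> W" for w
  proof (rule ccontr)
    assume "\<not> ?thesis"
    then have "real N * \<epsilon> < E s N w" by (simp add: E_def algebra_simps)
    then have "(real N * \<epsilon>)\<^sup>2 < (E s N w)\<^sup>2" using \<epsilon> by (intro power_strict_mono) auto
    also have "\<dots> \<le> (\<Sum>w\<in>W. (E s N w)\<^sup>2)" using that W(1) by (intro member_le_sum) auto
    also have "\<dots> \<le> real N * D" by (rule s)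
    finally have "real N * (real N * \<epsilon>\<^sup>2) < real N * D" by (simp add: power2_eq_square ac_simps)
    then have "real N * \<epsilon>\<^sup>2 < D" using \<open>0 < N\<close> by simp
    then show False using N \<epsilon> by (simp add: divide_less_eq)
  qed
  then show thesis using \<open>0 < N\<close> s(1) by (intro that[of N s]) (simp_all add: a_def)
qed

text \<open>A plan assigns to vectors \<open>ws\<close> and signs \<open>xs\<close> the probability of answering \<open>xs\<close> when \<open>ws\<close> is
  presented.  In this form randomised online strategies are a compact convex set on which the
  expected cost is linear.\<close>

definition is_plan :: "('a list \<times> real list \<Rightarrow> real) \<Rightarrow> bool" where
  "is_plan r \<longleftrightarrow> (\<forall>p. r p \<in> {0..1}) \<and> r ([], []) = 1 \<and>
    (\<forall>ws v xs. r (ws @ [v], xs @ [1]) + r (ws @ [v], xs @ [-1]) = r (ws, xs))"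

definition plan_cost :: "((nat \<Rightarrow> real) \<Rightarrow> real) \<Rightarrow> ((nat \<Rightarrow> real) list \<times> real list \<Rightarrow> real) \<Rightarrow> (nat \<Rightarrow> real) list \<Rightarrow> real" where
  "plan_cost \<phi> r ws = (\<Sum>xs\<in>sign_lists (length ws). r (ws, xs) * \<phi> (weighted_sum xs ws))"

lemma is_plan_strategy:
  assumes "range \<sigma> \<subseteq> {-1, 1}"
  shows "is_plan (\<lambda>(ws, xs). of_bool (xs = response \<sigma> ws))"
proof -
  have \<sigma>: "\<sigma> u = -1 \<or> \<sigma> u = 1" for u using assms by auto
  have "of_bool (xs @ [1] = response \<sigma> (ws @ [v])) + of_bool (xs @ [-1] = response \<sigma> (ws @ [v]))
      = (of_bool (xs = response \<sigma> ws) :: real)" for ws v xs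
    using \<sigma>[of "ws @ [v]"] by (elim disjE) (simp_all add: response_snoc)
  then show ?thesis by (auto simp: is_plan_def)
qed

lemma plan_cost_strategy:
  assumes "range \<sigma> \<subseteq> {-1, 1}"
  shows "plan_cost \<phi> (\<lambda>(ws, xs). of_bool (xs = response \<sigma> ws)) ws = \<phi> (weighted_sum (response \<sigma> ws) ws)"
  using response_in_sign_lists[OF assms, of ws]
  by (simp add: plan_cost_def of_bool_def if_distrib[where f = "\<lambda>c. c * _"] cong: if_cong)

lemma is_plan_average:
  assumes "0 < (N :: nat)" "\<And>j. is_plan (r j)"
  shows "is_plan (\<lambda>p. (\<Sum>j<N. r j p) / N)"
proof -
  have r: "0 \<le> r j p" "r j p \<le> 1" "r j ([], []) = 1"
    "r j (ws @ [v], xs @ [1]) + r j (ws @ [v], xs @ [-1]) = r j (ws, xs)" for j p ws v xs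
    using assms(2)[of j] by (cases p; simp add: is_plan_def)+
  have "(\<Sum>j<N. r j p) \<le> N" for p
    using sum_mono[of "{..<N}" "\<lambda>j. r j p" "\<lambda>_. 1"] r(2) by simp
  moreover have "(\<Sum>j<N. r j (ws @ [v], xs @ [1])) / N + (\<Sum>j<N. r j (ws @ [v], xs @ [-1])) / N
      = (\<Sum>j<N. r j (ws, xs)) / N" for ws v xs
    unfolding add_divide_distrib[symmetric] sum.distrib[symmetric] r(4) ..
  ultimately show ?thesis
    using assms(1) r(1,3) by (simp add: is_plan_def sum_nonneg divide_le_eq)
qed

lemma plan_cost_average:
  "plan_cost \<phi> (\<lambda>p. (\<Sum>j<N. r j p) / N) ws = (\<Sum>j<N. plan_cost \<phi> (r j) ws) / N" for N :: nat
proof -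
  have "plan_cost \<phi> (\<lambda>p. (\<Sum>j<N. r j p) / N) ws
      = (\<Sum>xs\<in>sign_lists (length ws). \<Sum>j<N. r j (ws, xs) * \<phi> (weighted_sum xs ws) / N)"
    by (simp add: plan_cost_def sum_divide_distrib sum_distrib_right)
  also have "\<dots> = (\<Sum>j<N. plan_cost \<phi> (r j) ws) / N"
    by (subst sum.swap) (simp add: plan_cost_def sum_divide_distrib)
  finally show ?thesis .
qed

text \<open>Tychonoff's theorem: plans are the points of a cube that satisfy equations in finitely
  many coordinates each, and such equations define closed sets in the product topology.\<close>

lemma compact_plans: "compact {r :: 'a list \<times> real list \<Rightarrow> real. is_plan r}"
proof -
  have coord: "continuous_on UNIV (\<lambda>r :: 'a list \<times> real list \<Rightarrow> real. r p)" for p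
    by (rule continuous_on_product_coordinates)
  have "compactin (product_topology (\<lambda>_. euclidean) UNIV) (PiE UNIV (\<lambda>_ :: 'a list \<times> real list. {0..1 :: real}))"
    by (subst compactin_PiE) simp
  then have "compact (PiE UNIV (\<lambda>_ :: 'a list \<times> real list. {0..1 :: real}))"
    by (simp add: euclidean_product_topology)
  moreover have "closed {r :: 'a list \<times> real list \<Rightarrow> real. r ([], []) = 1 \<and>
      (\<forall>ws v xs. r (ws @ [v], xs @ [1]) + r (ws @ [v], xs @ [-1]) = r (ws, xs))}"
    by (intro closed_Collect_conj closed_Collect_all closed_Collect_eq continuous_on_add coord continuous_on_const)
  ultimately have "compact (PiE UNIV (\<lambda>_ :: 'a list \<times> real list. {0..1 :: real}) \<inter> {r. r ([], []) = 1 \<and>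
      (\<forall>ws v xs. r (ws @ [v], xs @ [1]) + r (ws @ [v], xs @ [-1]) = r (ws, xs))})"
    by (rule compact_Int_closed)
  moreover have "PiE UNIV (\<lambda>_ :: 'a list \<times> real list. {0..1 :: real}) \<inter> {r. r ([], []) = 1 \<and>
      (\<forall>ws v xs. r (ws @ [v], xs @ [1]) + r (ws @ [v], xs @ [-1]) = r (ws, xs))} = {r. is_plan r}"
    by (auto simp: is_plan_def PiE_def Pi_def)
  ultimately show ?thesis by simp
qed

lemma closed_plan_cost: "closed {r. plan_cost \<phi> r ws \<le> b}"
proof -
  have coord: "continuous_on UNIV (\<lambda>r :: (nat \<Rightarrow> real) list \<times> real list \<Rightarrow> real. r p)" for p
    by (rule continuous_on_product_coordinates)
  show ?thesis
    unfolding plan_cost_def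
    by (intro closed_Collect_le continuous_on_sum continuous_on_mult coord continuous_on_const)
qed

text \<open>The finite intersection property removes the restriction to finitely many inputs. A
  mixture reaches \<open>B\<close> only up to a slack, so the slack is part of the index of the
  closed conditions; it vanishes once all of them hold for one plan.\<close>

lemma exists_good_plan:
  assumes \<phi>: "cost_fun n \<phi>" and B: "(\<integral>\<^sup>+x. \<phi> x \<partial>gaussian_measure n) \<le> ennreal B" "0 \<le> B"
  shows "\<exists>r. is_plan r \<and> (\<forall>ws. (\<forall>v\<in>set ws. short_vector n v) \<longrightarrow> plan_cost \<phi> r ws \<le> B)"
proof -
  define I where "I = {(ws, \<epsilon> :: real). (\<forall>v\<in>set ws. short_vector n v) \<and> 0 < \<epsilon>}"
  define C where "C = (\<lambda>(ws, \<epsilon>). {r. plan_cost \<phi> r ws \<le> B + \<epsilon>})"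
  have "{r. is_plan r} \<inter> (\<Inter>i\<in>I. C i) \<noteq> {}"
  proof (rule compact_imp_fip_image[OF compact_plans])
    fix i assume "i \<in> I" then show "closed (C i)" by (auto simp: C_def closed_plan_cost split: prod.splits)
  next
    fix J assume J: "finite J" "J \<subseteq> I"
    define \<epsilon> where "\<epsilon> = Min (insert 1 (snd ` J))"
    have \<epsilon>: "0 < \<epsilon>" "\<And>i. i \<in> J \<Longrightarrow> \<epsilon> \<le> snd i"
      unfolding \<epsilon>_def using J by (auto simp: I_def)
    obtain N s where N: "0 < (N :: nat)" "\<And>j. range (s j) \<subseteq> {-1, 1}"
      "\<And>w. w \<in> fst ` J \<Longrightarrow> (\<Sum>j<N. \<phi> (weighted_sum (response (s j) w) w)) \<le> N * (B + \<epsilon>)"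
      by (rule exists_strategy_mixture[OF \<phi> B, of "fst ` J" \<epsilon>]) (use J \<epsilon> in \<open>auto simp: I_def\<close>)
    define d where "d j = (\<lambda>(ws, xs). of_bool (xs = response (s j) ws) :: real)" for j
    define r where "r p = (\<Sum>j<N. d j p) / N" for p
    have "is_plan r"
      unfolding r_def d_def by (intro is_plan_average N is_plan_strategy)
    moreover have "r \<in> C i" if "i \<in> J" for i
    proof -
      have "plan_cost \<phi> r (fst i) = (\<Sum>j<N. \<phi> (weighted_sum (response (s j) (fst i)) (fst i))) / N"
        unfolding r_def plan_cost_average d_def by (simp add: plan_cost_strategy[OF N(2)])
      also have "\<dots> \<le> B + \<epsilon>" using N(1) N(3)[of "fst i"] that by (simp add: divide_le_eq mult.commute)
      also have "\<dots> \<le> B + snd i" using \<epsilon>(2)[OF that] by simp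
      finally show ?thesis by (simp add: C_def case_prod_beta)
    qed
    ultimately show "{r. is_plan r} \<inter> (\<Inter>i\<in>J. C i) \<noteq> {}" by blast
  qed
  then obtain r where r: "is_plan r" "\<And>i. i \<in> I \<Longrightarrow> r \<in> C i" by blast
  have "plan_cost \<phi> r ws \<le> B" if "\<forall>v\<in>set ws. short_vector n v" for ws
  proof (rule field_le_epsilon)
    fix \<epsilon> :: real assume "0 < \<epsilon>"
    then show "plan_cost \<phi> r ws \<le> B + \<epsilon>" using r(2)[of "(ws, \<epsilon>)"] that by (simp add: I_def C_def)
  qed
  then show ?thesis using r(1) by blast
qed

section \<open>Convex bodies and online algorithms\<close>

text \<open>For an interior point \<open>a\<close> and small \<open>x\<close>, both
  \<open>a + 2 *\<^sub>R x\<close> and, by symmetry, \<open>- a\<close> lie in \<open>K\<close>;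
  their midpoint is \<open>x\<close>.\<close>

lemma convex_body_contains_small:
  assumes K: "convex_body n K" "symmetric_set K"
  obtains \<delta> where "\<delta> > 0" "\<And>x. \<forall>i\<ge>n. x i = 0 \<Longrightarrow> (\<Sum>i<n. \<bar>x i\<bar>) < \<delta> \<Longrightarrow> x \<in> K"
proof -
  let ?E = "{x :: nat \<Rightarrow> real. \<forall>i\<ge>n. x i = 0}"
  obtain a where a: "a \<in> Euclidean_space n interior_of K" using K(1) by (auto simp: convex_body_def)
  define I where "I = Euclidean_space n interior_of K"
  have "openin (Euclidean_space n) I" unfolding I_def by (rule openin_interior_of)
  then obtain U where U: "openin (powertop_real UNIV) U" "I = U \<inter> ?E"
    unfolding Euclidean_space_def openin_subtopology by blast
  have aU: "a \<in> U" "a \<in> ?E" using a[folded I_def] U(2) by auto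
  obtain V where V: "a \<in> PiE UNIV V" "\<And>i. open (V i)" "PiE UNIV V \<subseteq> U"
    using product_topology_open_contains_basis[OF U(1) aU(1)] by auto
  have "\<exists>e>0. \<forall>y. \<bar>y - a i\<bar> < e \<longrightarrow> y \<in> V i" for i
    using V(1,2) by (auto simp: open_dist dist_real_def PiE_def Pi_def)
  then obtain e where e: "\<And>i. 0 < e i" "\<And>i y. \<bar>y - a i\<bar> < e i \<Longrightarrow> y \<in> V i" by metis
  \<comment> \<open>Halving absorbs the factor 2 in \<open>a + 2 *\<^sub>R x\<close>; inserting 1
    gives the minimum a meaning when \<open>n = 0\<close>.\<close>
  define \<delta> where "\<delta> = Min (insert 1 (e ` {..<n})) / 2"
  have \<delta>: "0 < \<delta>" "\<And>i. i < n \<Longrightarrow> 2 * \<delta> \<le> e i" using e(1) by (auto simp: \<delta>_def)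
  have "x \<in> K" if x: "\<forall>i\<ge>n. x i = 0" "(\<Sum>i<n. \<bar>x i\<bar>) < \<delta>" for x
  proof -
    have "(a + 2 *\<^sub>R x) i \<in> V i" for i
    proof (cases "i < n")
      case True
      then have "\<bar>x i\<bar> \<le> (\<Sum>i<n. \<bar>x i\<bar>)" by (intro member_le_sum) auto
      then show ?thesis using x(2) \<delta>(2)[OF True] by (intro e(2)) (simp add: abs_mult)
    qed (use x(1) V(1) in auto)
    then have "a + 2 *\<^sub>R x \<in> PiE UNIV V" by (simp add: PiE_UNIV_domain)
    then have "a + 2 *\<^sub>R x \<in> U \<inter> ?E" using V(3) aU(2) x(1) by auto
    then have 1: "a + 2 *\<^sub>R x \<in> K" unfolding U(2)[symmetric] I_def by (rule subsetD[OF interior_of_subset])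
    have "a \<in> K" using a by (rule subsetD[OF interior_of_subset])
    then have 2: "- a \<in> K" using K(2) by (auto simp: symmetric_set_def fun_Compl_def)
    have "(\<lambda>i. 1 / 2 * (a + 2 *\<^sub>R x) i + 1 / 2 * (- a) i) \<in> K"
      by (rule K(1)[unfolded convex_body_def convex_fun_set_def, THEN conjunct1, rule_format, OF 1 2]) auto
    also have "(\<lambda>i. 1 / 2 * (a + 2 *\<^sub>R x) i + 1 / 2 * (- a) i) = x"
      by (auto simp: fun_eq_iff algebra_simps)
    finally show ?thesis .
  qed
  then show thesis using that \<delta>(1) by blast
qed

lemma convex_body_gauge:
  assumes K: "convex_body n K" "symmetric_set K"
  obtains N where "is_seminorm N" "coord_lipschitz n N" "\<And>x. x \<in> K \<Longrightarrow> N x \<le> 1"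
    "\<And>x r. \<forall>i\<ge>n. x i = 0 \<Longrightarrow> N x < r \<Longrightarrow> x \<in> scale_set r K"
proof -
  obtain \<delta> where \<delta>: "\<delta> > 0" and small: "\<And>x. \<forall>i\<ge>n. x i = 0 \<Longrightarrow> (\<Sum>i<n. \<bar>x i\<bar>) < \<delta> \<Longrightarrow> x \<in> K"
    using convex_body_contains_small[OF K] by blast
  have K0: "0 \<in> K" using small[of 0] \<delta> by simp
  have sym: "- x \<in> K" if "x \<in> K" for x
    using K(2) that by (auto simp: symmetric_set_def fun_Compl_def)
  have conv: "u *\<^sub>R x + v *\<^sub>R y \<in> K" if "x \<in> K" "y \<in> K" "0 \<le> u" "0 \<le> v" "u + v = 1" for x y u v
    using K(1) that by (simp add: convex_body_def convex_fun_set_def plus_fun_def scaleR_fun_def)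
  have KE: "\<forall>i\<ge>n. x i = 0" if "x \<in> K" for x
    using K(1) that compactin_subset_topspace by (fastforce simp: convex_body_def topspace_Euclidean_space)
  \<comment> \<open>Projecting first makes the gauge a real-valued function on all of
    \<open>nat => real\<close> that depends on the first \<open>n\<close> coordinates only.\<close>
  define z where "z = zero_extend n"
  have z: "z (x + y) = z x + z y" "z (c *\<^sub>R x) = c *\<^sub>R z x" "\<forall>i\<ge>n. z x i = 0" "(\<Sum>i<n. \<bar>z x i\<bar>) = (\<Sum>i<n. \<bar>x i\<bar>)" for x y c
    by (auto simp: z_def zero_extend_def)
  have zid: "z x = x" if "\<forall>i\<ge>n. x i = 0" for x
    using that by (auto simp: z_def zero_extend_def fun_eq_iff)
  define S where "S x = {r. 0 < r \<and> (1 / r) *\<^sub>R z x \<in> K}" for x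
  define N where "N x = Inf (S x)" for x
  have bdd: "bdd_below (S x)" for x by (auto simp: S_def intro!: bdd_belowI[of _ 0])
  have inS: "r \<in> S x" if "(\<Sum>i<n. \<bar>x i\<bar>) < \<delta> * r" for r x
  proof -
    have "0 \<le> (\<Sum>i<n. \<bar>x i\<bar>)" by (intro sum_nonneg) auto
    then have r: "0 < r" using that \<delta> by (meson less_le_trans not_le order_le_less_trans zero_less_mult_pos)
    have "(1 / r) *\<^sub>R z x \<in> K"
      using that r z(3,4) by (intro small) (simp_all add: abs_mult divide_less_eq flip: sum_divide_distrib)
    then show ?thesis using r by (simp add: S_def)
  qed
  have ne: "S x \<noteq> {}" for x
  proof -
    have "(\<Sum>i<n. \<bar>x i\<bar>) < \<delta> * ((\<Sum>i<n. \<bar>x i\<bar>) / \<delta> + 1)" using \<delta> by (simp add: field_simps)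
    then show ?thesis using inS by blast
  qed
  have N_le: "N x \<le> r" if "r \<in> S x" for x r
    unfolding N_def using that bdd by (intro cInf_lower)
  have N0: "0 \<le> N x" for x
    unfolding N_def using ne by (intro cInf_greatest) (auto simp: S_def)
  \<comment> \<open>Contraction towards 0 stays in \<open>K\<close>, so \<open>S x\<close> contains
    everything above its infimum. The strict inequality avoids asking whether the infimum is
    attained.\<close>
  have up: "r \<in> S x" if lt: "N x < r" for x r
  proof -
    obtain q where q: "q \<in> S x" "q < r" using cInf_lessD[OF ne lt[unfolded N_def]] by blast
    then have q': "0 < q" "(1 / q) *\<^sub>R z x \<in> K" by (auto simp: S_def)
    have "(q / r) *\<^sub>R ((1 / q) *\<^sub>R z x) + (1 - q / r) *\<^sub>R 0 \<in> K"
      using q q' by (intro conv K0) auto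
    then show ?thesis using q q' by (simp add: S_def)
  qed
  have N_sum: "N x \<le> (\<Sum>i<n. \<bar>x i\<bar>) / \<delta>" for x
  proof (rule field_le_epsilon)
    fix e :: real assume "0 < e"
    then show "N x \<le> (\<Sum>i<n. \<bar>x i\<bar>) / \<delta> + e" using \<delta> by (intro N_le inS) (simp add: field_simps)
  qed
  have tri: "N (x + y) \<le> N x + N y" for x y
  proof (rule field_le_epsilon)
    fix e :: real assume e: "0 < e"
    define r where "r = N x + e / 2"
    define s where "s = N y + e / 2"
    have "r \<in> S x" "s \<in> S y" using up[of x r] up[of y s] e by (auto simp: r_def s_def)
    then have rs: "0 < r" "0 < s" "(1 / r) *\<^sub>R z x \<in> K" "(1 / s) *\<^sub>R z y \<in> K" by (auto simp: S_def)
    have "(r / (r + s)) *\<^sub>R ((1 / r) *\<^sub>R z x) + (s / (r + s)) *\<^sub>R ((1 / s) *\<^sub>R z y) \<in> K"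
      using rs by (intro conv) (auto simp flip: add_divide_distrib)
    also have "(r / (r + s)) *\<^sub>R ((1 / r) *\<^sub>R z x) + (s / (r + s)) *\<^sub>R ((1 / s) *\<^sub>R z y) = (1 / (r + s)) *\<^sub>R z (x + y)"
      using rs by (simp add: z scaleR_add_right)
    finally have "(1 / (r + s)) *\<^sub>R z (x + y) \<in> K" .
    then have "r + s \<in> S (x + y)" using rs by (simp only: S_def mem_Collect_eq add_pos_pos)
    then have "N (x + y) \<le> r + s" by (rule N_le)
    then show "N (x + y) \<le> N x + N y + e" by (simp add: r_def s_def)
  qed
  have hom_le: "N (c *\<^sub>R x) \<le> \<bar>c\<bar> * N x" for c x
  proof (cases "c = 0")
    case True
    then show ?thesis using N_sum[of 0] by simp
  next
    case False
    show ?thesis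
    proof (rule field_le_epsilon)
      fix e :: real assume e: "0 < e"
      define r where "r = N x + e / \<bar>c\<bar>"
      have "r \<in> S x" using up[of x r] e False by (simp add: r_def)
      then have r: "0 < r" "(1 / r) *\<^sub>R z x \<in> K" by (auto simp: S_def)
      have "(1 / (\<bar>c\<bar> * r)) *\<^sub>R z (c *\<^sub>R x) = (if 0 < c then (1 / r) *\<^sub>R z x else - ((1 / r) *\<^sub>R z x))"
        using False r(1) by (auto simp: z(2))
      then have "\<bar>c\<bar> * r \<in> S (c *\<^sub>R x)" using r False sym by (auto simp: S_def)
      then have "N (c *\<^sub>R x) \<le> \<bar>c\<bar> * r" by (rule N_le)
      then show "N (c *\<^sub>R x) \<le> \<bar>c\<bar> * N x + e" using False by (simp add: r_def distrib_left)
    qed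
  qed
  have hom: "N (c *\<^sub>R x) = \<bar>c\<bar> * N x" for c x
  proof (cases "c = 0")
    case True
    then show ?thesis using hom_le[of c x] N0[of "c *\<^sub>R x"] by simp
  next
    case False
    then have "\<bar>c\<bar> * N x \<le> \<bar>c\<bar> * (\<bar>1 / c\<bar> * N (c *\<^sub>R x))"
      using hom_le[of "1 / c" "c *\<^sub>R x"] by (intro mult_left_mono) auto
    then show ?thesis using hom_le[of c x] False by simp
  qed
  show thesis
  proof (rule that)
    show "is_seminorm N" using tri hom by (simp add: is_seminorm_def)
    have "N x \<le> N y + (1 / \<delta>) * (\<Sum>i<n. \<bar>x i - y i\<bar>)" for x y
      using tri[of y "x - y"] N_sum[of "x - y"] by simp
    then show "coord_lipschitz n N"
      unfolding coord_lipschitz_def using \<delta> by (intro exI[of _ "1 / \<delta>"]) auto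
    show "N x \<le> 1" if "x \<in> K" for x
      using that zid[OF KE[OF that]] by (intro N_le) (simp add: S_def)
    show "x \<in> scale_set r K" if "\<forall>i\<ge>n. x i = 0" "N x < r" for x r
    proof -
      have "0 < r" "(1 / r) *\<^sub>R x \<in> K" using up[OF that(2)] zid[OF that(1)] by (auto simp: S_def)
      then show ?thesis
        unfolding scale_set_def by (intro image_eqI[of _ _ "(1 / r) *\<^sub>R x"]) auto
    qed
  qed
qed

lemma cost_fun_seminorm_excess:
  assumes N: "is_seminorm N" "coord_lipschitz n N"
  shows "cost_fun n (\<lambda>x. max 0 (N x - 1))"
proof -
  have "convex_on UNIV (\<lambda>x. max 0 (N x - 1))"
  proof (rule convex_onI)
    fix t :: real and x y assume t: "0 < t" "t < 1"
    have "N ((1 - t) *\<^sub>R x + t *\<^sub>R y) \<le> (1 - t) * N x + t * N y"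
      using N(1) t by (metis abs_of_pos diff_gt_0_iff_gt is_seminorm_def)
    then have "N ((1 - t) *\<^sub>R x + t *\<^sub>R y) - 1 \<le> (1 - t) * (N x - 1) + t * (N y - 1)"
      by (simp add: algebra_simps)
    also have "\<dots> \<le> (1 - t) * max 0 (N x - 1) + t * max 0 (N y - 1)"
      using t by (intro add_mono mult_left_mono) auto
    finally show "max 0 (N ((1 - t) *\<^sub>R x + t *\<^sub>R y) - 1) \<le> (1 - t) * max 0 (N x - 1) + t * max 0 (N y - 1)"
      using t by simp
  qed simp
  moreover obtain L where L: "L \<ge> 0" "\<And>x y. N x \<le> N y + L * (\<Sum>i<n. \<bar>x i - y i\<bar>)"
    using N(2) unfolding coord_lipschitz_def by blast
  have "max 0 (N x - 1) \<le> max 0 (N y - 1) + L * (\<Sum>i<n. \<bar>x i - y i\<bar>)" for x y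
    using L(2)[of x y] L(1) by (auto simp: max_def intro: sum_nonneg)
  then have "coord_lipschitz n (\<lambda>x. max 0 (N x - 1))"
    unfolding coord_lipschitz_def using L(1) by blast
  ultimately show ?thesis by (simp add: cost_fun_def)
qed

text \<open>The next sign is 1 with the conditional probability that the plan assigns to it given
  the history. On histories of probability zero the quotient \<open>0 / 0\<close> is 0 and the sign
  -1 is played. Dividing by 8 turns unit vectors into short ones.\<close>

definition plan_algorithm :: "((nat \<Rightarrow> real) list \<times> real list \<Rightarrow> real) \<Rightarrow> online_algorithm" where
  "plan_algorithm r vs xs = (let ws = map ((*\<^sub>R) (1 / 8)) vs; a = r (ws, xs @ [1]); b = r (ws, xs @ [-1])
    in map_pmf (\<lambda>c. if c then 1 else -1) (bernoulli_pmf (a / (a + b))))"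

lemma sign_valued_plan_algorithm: "sign_valued (plan_algorithm r)"
  by (auto simp: sign_valued_def plan_algorithm_def Let_def)

text \<open>Multiplying by the probability of the history instead of dividing by it covers histories
  of probability zero: there both continuations have probability zero as well.\<close>

lemma nn_integral_plan_algorithm:
  fixes g :: "real \<Rightarrow> ennreal"
  assumes "is_plan r" "ws = map ((*\<^sub>R) (1 / 8)) (vs @ [v])"
  shows "ennreal (r (butlast ws, xs)) * (\<integral>\<^sup>+s. g s \<partial>plan_algorithm r (vs @ [v]) xs)
    = ennreal (r (ws, xs @ [1])) * g 1 + ennreal (r (ws, xs @ [-1])) * g (-1)"
proof -
  define a where "a = r (ws, xs @ [1])"
  define b where "b = r (ws, xs @ [-1])"
  have r: "0 \<le> a" "0 \<le> b" "r (butlast ws, xs) = a + b"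
    using assms by (auto simp: is_plan_def a_def b_def)
  have p: "0 \<le> a / (a + b)" "a / (a + b) \<le> 1" using r by (auto simp: divide_le_eq)
  have "(\<integral>\<^sup>+s. g s \<partial>plan_algorithm r (vs @ [v]) xs)
      = ennreal (a / (a + b)) * g 1 + ennreal (1 - a / (a + b)) * g (-1)"
    unfolding plan_algorithm_def Let_def assms(2)[symmetric] a_def[symmetric] b_def[symmetric]
    using p by (simp add: nn_integral_bernoulli_pmf mult.commute)
  then have "ennreal (r (butlast ws, xs)) * (\<integral>\<^sup>+s. g s \<partial>plan_algorithm r (vs @ [v]) xs)
      = ennreal ((a + b) * (a / (a + b))) * g 1 + ennreal ((a + b) * (1 - a / (a + b))) * g (-1)"
    using p r by (subst (1 2) ennreal_mult) (simp_all add: distrib_left mult.assoc del: ennreal_plus)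
  moreover have "(a + b) * (a / (a + b)) = a" "(a + b) * (1 - a / (a + b)) = b"
    using r by (auto simp: right_diff_distrib add_nonneg_eq_0_iff)
  ultimately show ?thesis by (simp only: a_def b_def)
qed

definition scaled_inputs :: "(nat \<Rightarrow> nat \<Rightarrow> real) \<Rightarrow> nat \<Rightarrow> (nat \<Rightarrow> real) list" where
  "scaled_inputs v t = map (\<lambda>i. (1 / 8) *\<^sub>R v i) [1..<Suc t]"

lemma length_scaled_inputs: "length (scaled_inputs v t) = t"
  by (simp add: scaled_inputs_def)

definition sign_history :: "nat \<Rightarrow> (nat \<Rightarrow> real) \<Rightarrow> real list" where
  "sign_history t x = map x [1..<Suc t]"

lemma sign_history_upd:
  "sign_history (Suc t) (x(Suc t := s)) = sign_history t x @ [s]"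
  "t \<le> T \<Longrightarrow> sign_history t (x(Suc T := s)) = sign_history t x"
  by (auto simp: sign_history_def)

lemma sum_sign_lists_Suc:
  "(\<Sum>xs\<in>sign_lists (Suc t). f xs) = (\<Sum>xs\<in>sign_lists t. f (xs @ [1]) + f (xs @ [-1]))"
proof -
  have "sign_lists (Suc t) = (\<lambda>xs. xs @ [1]) ` sign_lists t \<union> (\<lambda>xs. xs @ [-1]) ` sign_lists t"
  proof (intro equalityI subsetI)
    fix xs assume "xs \<in> sign_lists (Suc t)"
    then show "xs \<in> (\<lambda>xs. xs @ [1]) ` sign_lists t \<union> (\<lambda>xs. xs @ [-1]) ` sign_lists t"
      by (cases xs rule: rev_cases) (auto simp: sign_lists_def)
  qed (auto simp: sign_lists_def)
  then have "(\<Sum>xs\<in>sign_lists (Suc t). f xs) = (\<Sum>xs\<in>(\<lambda>xs. xs @ [1]) ` sign_lists t. f xs) + (\<Sum>xs\<in>(\<lambda>xs. xs @ [-1]) ` sign_lists t. f xs)"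
    by (simp only:) (rule sum.union_disjoint; auto)
  then show ?thesis by (simp add: sum.reindex inj_on_def sum.distrib)
qed

text \<open>The conditional probabilities multiply back to the plan, so \<open>r\<close> at the
  inputs is the law of the sign history. The arbitrary \<open>g\<close> lets the induction absorb
  the last random sign into the integrand.\<close>

lemma nn_integral_run_plan:
  fixes g :: "real list \<Rightarrow> ennreal"
  assumes "is_plan r"
  shows "(\<integral>\<^sup>+x. g (sign_history t x) \<partial>run_online (plan_algorithm r) v t)
    = (\<Sum>xs\<in>sign_lists t. ennreal (r (scaled_inputs v t, xs)) * g xs)"
proof (induction t arbitrary: g)
  case 0
  have "sign_lists 0 = {[]}" by (auto simp: sign_lists_def)
  then show ?case using assms by (simp add: is_plan_def sign_history_def scaled_inputs_def)
next
  case (Suc t)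
  define G where "G xs = (\<integral>\<^sup>+s. g (xs @ [s]) \<partial>plan_algorithm r (map v [1..<Suc t] @ [v (Suc t)]) xs)" for xs
  have ws: "scaled_inputs v (Suc t) = map ((*\<^sub>R) (1 / 8)) (map v [1..<Suc t] @ [v (Suc t)])"
    "butlast (scaled_inputs v (Suc t)) = scaled_inputs v t"
    by (simp_all add: scaled_inputs_def)
  have "(\<integral>\<^sup>+x. g (sign_history (Suc t) x) \<partial>run_online (plan_algorithm r) v (Suc t))
      = (\<integral>\<^sup>+x. G (sign_history t x) \<partial>run_online (plan_algorithm r) v t)"
    by (simp add: G_def nn_integral_bind_pmf sign_history_upd del: upt_Suc) (simp add: sign_history_def)
  also have "\<dots> = (\<Sum>xs\<in>sign_lists t. ennreal (r (scaled_inputs v t, xs)) * G xs)"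
    by (rule Suc.IH)
  also have "\<dots> = (\<Sum>xs\<in>sign_lists t. ennreal (r (scaled_inputs v (Suc t), xs @ [1])) * g (xs @ [1])
      + ennreal (r (scaled_inputs v (Suc t), xs @ [-1])) * g (xs @ [-1]))"
    unfolding G_def using nn_integral_plan_algorithm[OF assms ws(1), unfolded ws(2)]
    by (intro sum.cong refl)
  finally show ?case by (simp add: sum_sign_lists_Suc)
qed

text \<open>Later rounds leave earlier signs untouched. Hence the cost at each time \<open>t\<close>
  of one long run is governed by the plan on the first \<open>t\<close> inputs.\<close>

lemma nn_integral_run_prefix:
  fixes g :: "real list \<Rightarrow> ennreal"
  assumes "t \<le> T"
  shows "(\<integral>\<^sup>+x. g (sign_history t x) \<partial>run_online A v T) = (\<integral>\<^sup>+x. g (sign_history t x) \<partial>run_online A v t)"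
  using assms
proof (induction T rule: dec_induct)
  case (step T)
  then show ?case
    by (simp add: nn_integral_bind_pmf sign_history_upd(2) measure_pmf.emeasure_space_1 del: upt_Suc)
qed simp

lemma weighted_sum_snoc:
  "length xs = length ws \<Longrightarrow> weighted_sum (xs @ [x]) (ws @ [w]) = weighted_sum xs ws + x *\<^sub>R w"
  by (induction xs ws rule: list_induct2) (auto simp: add.assoc)

lemma signed_sum_eq: "signed_sum v x t = 8 *\<^sub>R weighted_sum (sign_history t x) (scaled_inputs v t)"
proof (induction t)
  case 0
  then show ?case by (simp add: signed_sum_def sign_history_def scaled_inputs_def fun_eq_iff)
next
  case (Suc t)
  have "signed_sum v x (Suc t) = signed_sum v x t + x (Suc t) *\<^sub>R v (Suc t)"
    by (simp add: signed_sum_def fun_eq_iff)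
  moreover have "sign_history (Suc t) x = sign_history t x @ [x (Suc t)]"
    "scaled_inputs v (Suc t) = scaled_inputs v t @ [(1 / 8) *\<^sub>R v (Suc t)]"
    "length (sign_history t x) = length (scaled_inputs v t)"
    by (simp_all add: sign_history_def scaled_inputs_def)
  ultimately show ?case using Suc by (simp add: weighted_sum_snoc scaleR_add_right)
qed

text \<open>Markov's inequality for the sum of the costs over \<open>S\<close>: its mean is at most
  8, and it is at least 16 as soon as one of the costs is. The set \<open>S\<close> is the single
  final time for (a) and all times for (b).\<close>

lemma plan_success_probability:
  fixes B :: real
  assumes r: "is_plan r" "\<And>ws. \<forall>v\<in>set ws. short_vector n v \<Longrightarrow> plan_cost \<phi> r ws \<le> B" and \<phi>: "\<And>x. 0 \<le> \<phi> x"
    and v: "\<And>i. i \<in> {1..T} \<Longrightarrow> short_vector n ((1 / 8) *\<^sub>R v i)"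
    and S: "S \<subseteq> {1..T}" "card S * B \<le> 8"
  shows "measure_pmf.prob (run_online (plan_algorithm r) v T)
    {x. \<forall>t\<in>S. \<phi> (weighted_sum (sign_history t x) (scaled_inputs v t)) < 16} \<ge> 1 / 2"
proof -
  let ?M = "run_online (plan_algorithm r) v T"
  define f where "f t x = \<phi> (weighted_sum (sign_history t x) (scaled_inputs v t))" for t x
  define bad where "bad = {x. \<exists>t\<in>S. 16 \<le> f t x}"
  have finS: "finite S" using S(1) finite_subset by blast
  have cost: "(\<integral>\<^sup>+x. f t x \<partial>?M) \<le> ennreal B" if "t \<in> S" for t
  proof -
    have t: "t \<le> T" "\<forall>w\<in>set (scaled_inputs v t). short_vector n w"
      using that S(1) v by (auto simp: scaled_inputs_def)
    have r0: "0 \<le> r p" for p using r(1) by (cases p) (simp add: is_plan_def)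
    have "(\<integral>\<^sup>+x. f t x \<partial>?M) = (\<Sum>xs\<in>sign_lists t. ennreal (r (scaled_inputs v t, xs)) * ennreal (\<phi> (weighted_sum xs (scaled_inputs v t))))"
      unfolding f_def nn_integral_run_prefix[OF t(1), where g = "\<lambda>xs. ennreal (\<phi> (weighted_sum xs (scaled_inputs v t)))"]
      by (rule nn_integral_run_plan[OF r(1)])
    also have "\<dots> = ennreal (plan_cost \<phi> r (scaled_inputs v t))"
      using \<phi> r0 by (simp add: plan_cost_def length_scaled_inputs ennreal_mult flip: sum_ennreal)
    also have "\<dots> \<le> ennreal B" by (intro ennreal_leI r t)
    finally show ?thesis .
  qed
  have "16 * emeasure ?M bad = (\<integral>\<^sup>+x. 16 * indicator bad x \<partial>?M)"
    by (simp add: nn_integral_cmult)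
  also have "\<dots> \<le> (\<integral>\<^sup>+x. (\<Sum>t\<in>S. ennreal (f t x)) \<partial>?M)"
  proof (intro nn_integral_mono)
    fix x
    show "16 * indicator bad x \<le> (\<Sum>t\<in>S. ennreal (f t x))"
    proof (cases "x \<in> bad")
      case True
      then obtain t where t: "t \<in> S" "16 \<le> f t x" by (auto simp: bad_def)
      then have "16 \<le> ennreal (f t x)" by (metis ennreal_leI ennreal_numeral)
      also have "\<dots> \<le> (\<Sum>t\<in>S. ennreal (f t x))" using t(1) finS by (intro member_le_sum) auto
      finally show ?thesis using True by simp
    qed simp
  qed
  also have "\<dots> = (\<Sum>t\<in>S. \<integral>\<^sup>+x. f t x \<partial>?M)" by (simp add: nn_integral_sum)
  also have "\<dots> \<le> (\<Sum>t\<in>S. ennreal B)" by (intro sum_mono cost)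
  also have "\<dots> = ennreal (card S * B)" by (simp add: ennreal_mult' ennreal_of_nat_eq_real_of_nat)
  also have "\<dots> \<le> ennreal 8" by (intro ennreal_leI S)
  finally have "ennreal (16 * measure ?M bad) \<le> ennreal 8"
    by (simp add: measure_pmf.emeasure_eq_measure ennreal_mult)
  then have "measure ?M bad \<le> 1 / 2" by (subst (asm) ennreal_le_iff) auto
  moreover have "{x. \<forall>t\<in>S. f t x < 16} = UNIV - bad" by (auto simp: bad_def not_le)
  moreover have "measure ?M (UNIV - bad) = 1 - measure ?M bad"
    using measure_pmf.prob_compl[of bad ?M] by simp
  ultimately show ?thesis by (simp add: f_def)
qed

theorem theorem1p2:
  shows "\<exists>C>0::real. \<forall>(n::nat) (K::(nat \<Rightarrow> real) set).
    convex_body n K \<and> symmetric_set K \<longrightarrow>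
    (\<exists>A::online_algorithm. sign_valued A \<and>
      (\<forall>(T::nat) (v::nat \<Rightarrow> nat \<Rightarrow> real).
        T \<ge> 1 \<and>
        (\<forall>i\<in>{1..T}. v i \<in> topspace (Euclidean_space n) \<and> euclidean_norm n (v i) \<le> 1) \<longrightarrow>
        (measure (gaussian_measure n) K \<ge> 1 / 2 \<longrightarrow>
          measure_pmf.prob (run_online A v T)
            {x. signed_sum v x T \<in> scale_set C K} \<ge> 1 / 2) \<and>
        (measure (gaussian_measure n) K \<ge> 1 - 1 / (2 * real T) \<longrightarrow>
          measure_pmf.prob (run_online A v T)
            {x. \<forall>t\<in>{1..T}. signed_sum v x t \<in> scale_set C K} \<ge> 1 / 2)))"
proof (intro exI[of _ "136 :: real"] conjI allI impI)
  fix n K assume "convex_body n K \<and> symmetric_set K"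
  then have K: "convex_body n K" "symmetric_set K" by auto
  define \<eta> where "\<eta> = 1 - measure (gaussian_measure n) K"
  show "\<exists>A::online_algorithm. sign_valued A \<and>
      (\<forall>(T::nat) (v::nat \<Rightarrow> nat \<Rightarrow> real).
        T \<ge> 1 \<and>
        (\<forall>i\<in>{1..T}. v i \<in> topspace (Euclidean_space n) \<and> euclidean_norm n (v i) \<le> 1) \<longrightarrow>
        (measure (gaussian_measure n) K \<ge> 1 / 2 \<longrightarrow>
          measure_pmf.prob (run_online A v T)
            {x. signed_sum v x T \<in> scale_set 136 K} \<ge> 1 / 2) \<and>
        (measure (gaussian_measure n) K \<ge> 1 - 1 / (2 * real T) \<longrightarrow>
          measure_pmf.prob (run_online A v T)
            {x. \<forall>t\<in>{1..T}. signed_sum v x t \<in> scale_set 136 K} \<ge> 1 / 2))"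
  proof (cases "\<eta> \<le> 1 / 2")
    case False
    \<comment> \<open>If \<open>K\<close> has measure below \<open>1 / 2\<close>, the hypotheses of
      (a) and (b) both fail for every admissible T, so any sign-valued algorithm will do.\<close>
    have "\<not> 1 - 1 / (2 * real T) \<le> measure (gaussian_measure n) K" if "1 \<le> T" for T
    proof -
      have "1 / (2 * real T) \<le> 1 / 2" using that by (intro divide_left_mono) auto
      then show ?thesis using False by (simp add: \<eta>_def)
    qed
    then show ?thesis
      using False by (intro exI[of _ "\<lambda>_ _. return_pmf 1"]) (auto simp: sign_valued_def \<eta>_def)
  next
    case True
    interpret \<gamma>: prob_space "gaussian_measure n" by (rule prob_space_gaussian_measure)
    have sp: "space (gaussian_measure n) = UNIV" by (simp add: gaussian_measure_def)
    obtain N where N: "is_seminorm N" "coord_lipschitz n N" "\<And>x. x \<in> K \<Longrightarrow> N x \<le> 1"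
      "\<And>x r. \<forall>i\<ge>n. x i = 0 \<Longrightarrow> N x < r \<Longrightarrow> x \<in> scale_set r K"
      using convex_body_gauge[OF K] by blast
    define \<phi> where "\<phi> x = max 0 (N x - 1)" for x
    have \<phi>: "cost_fun n \<phi>" unfolding \<phi>_def by (rule cost_fun_seminorm_excess[OF N(1,2)])
    have [measurable]: "N \<in> borel_measurable borel"
      using coord_lipschitz_continuous[OF N(2)] by (rule borel_measurable_continuous_onI)
    have [measurable]: "K \<in> sets borel" by (rule convex_body_borel[OF K(1)])
    have "measure (gaussian_measure n) {x. 1 < N x} \<le> measure (gaussian_measure n) (UNIV - K)"
      using N(3) by (intro \<gamma>.finite_measure_mono) (auto simp: not_less[symmetric])
    also have "\<dots> = \<eta>" using \<gamma>.prob_compl[of K] by (simp add: sp \<eta>_def)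
    finally have "(\<integral>\<^sup>+x. \<phi> x \<partial>gaussian_measure n) \<le> ennreal (16 * \<eta>)"
      unfolding \<phi>_def using True by (intro nn_integral_gaussian_seminorm_excess N(1)) auto
    moreover have "0 \<le> 16 * \<eta>" by (simp add: \<eta>_def)
    ultimately have "\<exists>r. is_plan r \<and> (\<forall>ws. (\<forall>v\<in>set ws. short_vector n v) \<longrightarrow> plan_cost \<phi> r ws \<le> 16 * \<eta>)"
      by (rule exists_good_plan[OF \<phi>])
    then obtain r where r: "is_plan r" "\<And>ws. \<forall>v\<in>set ws. short_vector n v \<Longrightarrow> plan_cost \<phi> r ws \<le> 16 * \<eta>"
      by blast
    \<comment> \<open>The bound \<open>16 * \<eta>\<close> per time keeps the total cost at most 8
      exactly when \<open>card S * \<eta> \<le> 1 / 2\<close>. The algorithm does not depend on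
      \<open>S\<close>, so it serves both parts.\<close>
    have success: "measure_pmf.prob (run_online (plan_algorithm r) v T) {x. \<forall>t\<in>S. signed_sum v x t \<in> scale_set 136 K} \<ge> 1 / 2"
      if v: "\<forall>i\<in>{1..T}. v i \<in> topspace (Euclidean_space n) \<and> euclidean_norm n (v i) \<le> 1"
        and S: "S \<subseteq> {1..T}" "card S * \<eta> \<le> 1 / 2" for T v S
    proof -
      have short: "short_vector n ((1 / 8) *\<^sub>R v i)" if "i \<in> {1..T}" for i
      proof -
        have "(\<Sum>k<n. (v i k)\<^sup>2) \<le> 1"
          using v that by (simp add: euclidean_norm_def L2_set_def)
        then show ?thesis
          using v that by (simp add: short_vector_def topspace_Euclidean_space power_divide flip: sum_divide_distrib)
      qed
      have "1 / 2 \<le> measure_pmf.prob (run_online (plan_algorithm r) v T)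
          {x. \<forall>t\<in>S. \<phi> (weighted_sum (sign_history t x) (scaled_inputs v t)) < 16}"
        by (rule plan_success_probability[OF r cost_fun_nonneg[OF \<phi>] short S(1)]) (use S(2) in \<open>simp_all add: ac_simps\<close>)
      also have "\<dots> \<le> measure_pmf.prob (run_online (plan_algorithm r) v T) {x. \<forall>t\<in>S. signed_sum v x t \<in> scale_set 136 K}"
      proof (intro measure_pmf.finite_measure_mono subsetI CollectI ballI)
        fix x t assume x: "x \<in> {x. \<forall>t\<in>S. \<phi> (weighted_sum (sign_history t x) (scaled_inputs v t)) < 16}" and t: "t \<in> S"
        define y where "y = weighted_sum (sign_history t x) (scaled_inputs v t)"
        have sy: "signed_sum v x t = 8 *\<^sub>R y" by (simp add: signed_sum_eq y_def)
        \<comment> \<open>An excess below 16 is a gauge below 17; undoing the division of the inputs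
          by 8 gives \<open>136 = 8 * 17\<close>.\<close>
        have "N y < 17" using x t by (auto simp: \<phi>_def y_def)
        moreover have "signed_sum v x t i = 0" if "n \<le> i" for i
          using v t S(1) that by (auto simp: signed_sum_def topspace_Euclidean_space intro!: sum.neutral)
        then have "\<forall>i\<ge>n. y i = 0" by (simp add: sy)
        ultimately have "y \<in> scale_set 17 K" using N(4) by blast
        then obtain k where "k \<in> K" "y = (\<lambda>i. 17 * k i)" by (auto simp: scale_set_def)
        then show "signed_sum v x t \<in> scale_set 136 K"
          unfolding sy scale_set_def by (intro image_eqI[of _ _ k]) (auto simp: fun_eq_iff)
      qed simp
      finally show ?thesis .
    qed
    show ?thesis
    proof (intro exI[of _ "plan_algorithm r"] conjI allI impI sign_valued_plan_algorithm)
      fix T :: nat and v :: "nat \<Rightarrow> nat \<Rightarrow> real"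
      assume *: "T \<ge> 1 \<and> (\<forall>i\<in>{1..T}. v i \<in> topspace (Euclidean_space n) \<and> euclidean_norm n (v i) \<le> 1)"
      show "1 / 2 \<le> measure_pmf.prob (run_online (plan_algorithm r) v T) {x. signed_sum v x T \<in> scale_set 136 K}"
        using success[of T v "{T}"] * True by simp
      assume "1 - 1 / (2 * real T) \<le> measure (gaussian_measure n) K"
      then have "real T * \<eta> \<le> 1 / 2" using * by (simp add: \<eta>_def field_simps)
      then show "1 / 2 \<le> measure_pmf.prob (run_online (plan_algorithm r) v T) {x. \<forall>t\<in>{1..T}. signed_sum v x t \<in> scale_set 136 K}"
        using success[of T v "{1..T}"] * by simp
    qed
  qed
qed simp

end
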